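(* Let $l,\alpha,k>0$. Let $\mathbf{M}\in\mathrm{wp}(4,8,\mathbb{C})$ and $w\in L^2[-l,l]$. Then $\mathcal{K}_{\mathbf{M}}[w]$ is the unique solution of the boundary value problem consisting of the differential equation $$u^{(4)}+\alpha^4u=\frac{\alpha^4}{k}\cdot w\quad\text{on }[-l,l]$$ and the boundary condition $\mathbf{M}\cdot\mathcal{B}[u]=\mathbf{0}$.
   Context: Fix $l,\alpha,k>0$. $\mathrm{gl}(m,n,\mathbb{C})$ is the set of complex $m\times n$ matrices, $\mathrm{gl}(n,\mathbb{C})=\mathrm{gl}(n,n,\mathbb{C})$; $L^2[-l,l]$ is the Hilbert space of complex-valued square-integrable functions. For $w\in L^2[-l,l]$, a solution of the differential equation is a function $u\in C^3[-l,l]$ with $u'''$ absolutely continuous satisfying the equation almost everywhere. Matrices. $\omega_j=e^{\sqrt{-1}\,\frac{\pi}{4}(2j-1)}$ ($j\in\mathbb{Z}$), $\mathbf{\Omega}=\mathrm{diag}(\omega_1,\omega_2,\omega_3,\omega_4)$, and $\mathbf{L}^2=\begin{pmatrix}0&0&1&0\\0&0&0&1\\1&0&0&0\\0&1&0&0\end{pmatrix}$. Let $\mathbf{y}(x)=(e^{\omega_1\alpha x},e^{\omega_2\alpha x},e^{\omega_3\alpha x},e^{\omega_4\alpha x})^T$ and $\mathbf{W}(x)=\left((\omega_q\alpha)^{p-1}e^{\omega_q\alpha x}\right)_{1\le p,q\le 4}$ (row index $p$, column index $q$). Well-posedness. Write $\mathbf{M}=(\mathbf{M}^-\ \mathbf{M}^+)\in\mathrm{gl}(4,8,\mathbb{C})$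 with $\mathbf{M}^\pm\in\mathrm{gl}(4,\mathbb{C})$. For $u\in C^3[-l,l]$, $\mathcal{B}[u]=(u(-l),u'(-l),u''(-l),u'''(-l),u(l),u'(l),u''(l),u'''(l))^T$. $\mathbf{M}$ is well-posed if $u=0$ is the only solution of $u^{(4)}+\alpha^4u=0$ on $[-l,l]$ with $\mathbf{M}\cdot\mathcal{B}[u]=\mathbf{0}$; $\mathrm{wp}(4,8,\mathbb{C})$ is the set of well-posed matrices. Put $\widetilde{\mathbf{M}}^-=\mathbf{M}^-\mathbf{W}(-l)$, $\widetilde{\mathbf{M}}^+=\mathbf{M}^+\mathbf{W}(l)$, $\widetilde{\mathbf{M}}=\widetilde{\mathbf{M}}^-+\widetilde{\mathbf{M}}^+$ (invertible when $\mathbf{M}$ is well-posed). For well-posed $\mathbf{M}$ let $\mathbf{G}_{\mathbf{M}}^\pm=\widetilde{\mathbf{M}}^{-1}\widetilde{\mathbf{M}}^\pm\mathbf{\Omega}\mathbf{L}^2$. Operator. $G_{\mathbf{M}}(x,\xi)=\frac{\alpha}{4k}\mathbf{y}(x)^T\mathbf{G}_{\mathbf{M}}^+\mathbf{y}(\xi)$ if $x\le\xi$ and $-\frac{\alpha}{4k}\mathbf{y}(x)^T\mathbf{G}_{\mathbf{M}}^-\mathbf{y}(\xi)$ if $\xi\le x$ (the two expressions agree for $x=\xi$), and $\mathcal{K}_{\mathbf{M}}:L^2[-l,l]\to L^2[-l,l]$ is $\mathcal{K}_{\mathbf{M}}[w](x)=\int_{-l}^lG_{\mathbf{M}}(x,\xi)w(\xi)\,d\xi$.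 *)

theory Defs
  imports "HOL-Analysis.Analysis"
begin

text \<open>
  Vectors and matrices are the library's finite Cartesian types; the index types 4 and 8 are
  enumerated as \<open>1, 2, 3, 4\<close> and \<open>1, \<dots>, 8\<close> (the last index being equal to \<open>0\<close> in the index type,
  as for the library function \<^const>\<open>vector\<close>).  Matrices given by a formula in their row and
  column number are built from natural numbers \<open>p\<close>, \<open>q\<close> ranging over \<open>1, 2, 3, 4\<close>.
\<close>

definition mat4 :: "(nat \<Rightarrow> nat \<Rightarrow> complex) \<Rightarrow> complex^4^4" where
  "mat4 f = vector (map (\<lambda>p. vector (map (\<lambda>q. f p q) [1, 2, 3, 4])) [1, 2, 3, 4])"

definition omega :: "int \<Rightarrow> complex" where
  "omega j = exp (\<i> * complex_of_real (pi / 4 * (2 * real_of_int j - 1)))"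

definition Omega :: "complex^4^4" where
  "Omega = mat4 (\<lambda>p q. if p = q then omega (int p) else 0)"

definition Lsq :: "complex^4^4" where
  "Lsq = vector [vector [0, 0, 1, 0],
                 vector [0, 0, 0, 1],
                 vector [1, 0, 0, 0],
                 vector [0, 1, 0, 0]]"

definition yvec :: "real \<Rightarrow> real \<Rightarrow> complex^4" where
  "yvec \<alpha> x = vector (map (\<lambda>j. exp (omega j * complex_of_real \<alpha> * complex_of_real x)) [1, 2, 3, 4])"

definition Wmat :: "real \<Rightarrow> real \<Rightarrow> complex^4^4" where
  "Wmat \<alpha> x = mat4 (\<lambda>p q. (omega (int q) * complex_of_real \<alpha>) ^ (p - 1)
                          * exp (omega (int q) * complex_of_real \<alpha> * complex_of_real x))"

text \<open>The left and right halves of \<open>M = (M\<^sup>- M\<^sup>+)\<close>: columns 1--4 and columns 5--8.\<close>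

definition Mminus :: "complex^8^4 \<Rightarrow> complex^4^4" where
  "Mminus M = mat4 (\<lambda>p q. M $ of_nat p $ of_nat q)"

definition Mplus :: "complex^8^4 \<Rightarrow> complex^4^4" where
  "Mplus M = mat4 (\<lambda>p q. M $ of_nat p $ of_nat (q + 4))"

text \<open>
  Functions on \<open>[-l, l]\<close> are represented by functions on the reals of which only the values on
  \<open>[-l, l]\<close> matter.  Derivatives are relative to the closed interval, so they are one-sided at
  the end points.
\<close>

definition nderiv :: "real \<Rightarrow> nat \<Rightarrow> (real \<Rightarrow> complex) \<Rightarrow> real \<Rightarrow> complex" where
  "nderiv l n u = ((\<lambda>f x. vector_derivative f (at x within {-l..l})) ^^ n) u"

definition C3_on :: "real \<Rightarrow> (real \<Rightarrow> complex) \<Rightarrow> bool" where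
  "C3_on l u \<longleftrightarrow> (\<forall>n<3. nderiv l n u differentiable_on {-l..l}) \<and>
                continuous_on {-l..l} (nderiv l 3 u)"

text \<open>
  Absolute continuity of a function on \<open>[a, b]\<close> (the library constant
  \<^const>\<open>absolutely_continuous\<close> is about measures).  The set \<open>P\<close> is a finite family of
  subintervals \<open>(s, t)\<close>, represented by their pairs of end points.
\<close>

definition abs_continuous_fun :: "real \<Rightarrow> real \<Rightarrow> (real \<Rightarrow> complex) \<Rightarrow> bool" where
  "abs_continuous_fun a b f \<longleftrightarrow>
     (\<forall>\<epsilon>>0. \<exists>\<delta>>0. \<forall>P :: (real \<times> real) set.
        finite P \<and> (\<forall>(s, t)\<in>P. a \<le> s \<and> s < t \<and> t \<le> b) \<and>
        pairwise (\<lambda>I J. disjnt {fst I<..<snd I} {fst J<..<snd J}) P \<and>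
        (\<Sum>(s, t)\<in>P. t - s) < \<delta>
        \<longrightarrow> (\<Sum>(s, t)\<in>P. cmod (f t - f s)) < \<epsilon>)"

text \<open>
  Solutions of \<open>u'''' + \<alpha>\<^sup>4 u = f\<close> on \<open>[-l, l]\<close>.  Existence of the fourth derivative \<open>d\<close> is stated
  explicitly, since \<^const>\<open>vector_derivative\<close> is total.
\<close>

definition ode_solution :: "real \<Rightarrow> real \<Rightarrow> (real \<Rightarrow> complex) \<Rightarrow> (real \<Rightarrow> complex) \<Rightarrow> bool" where
  "ode_solution l \<alpha> f u \<longleftrightarrow>
     C3_on l u \<and> abs_continuous_fun (-l) l (nderiv l 3 u) \<and>
     (AE x in lebesgue_on {-l..l}.
        \<exists>d. (nderiv l 3 u has_vector_derivative d) (at x within {-l..l}) \<and>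
            d + complex_of_real (\<alpha>^4) * u x = f x)"

definition bdry :: "real \<Rightarrow> (real \<Rightarrow> complex) \<Rightarrow> complex^8" where
  "bdry l u = vector [nderiv l 0 u (-l), nderiv l 1 u (-l), nderiv l 2 u (-l), nderiv l 3 u (-l),
                      nderiv l 0 u l, nderiv l 1 u l, nderiv l 2 u l, nderiv l 3 u l]"

definition bvp_solution ::
  "real \<Rightarrow> real \<Rightarrow> complex^8^4 \<Rightarrow> (real \<Rightarrow> complex) \<Rightarrow> (real \<Rightarrow> complex) \<Rightarrow> bool" where
  "bvp_solution l \<alpha> M f u \<longleftrightarrow> ode_solution l \<alpha> f u \<and> M *v bdry l u = 0"

definition wp :: "real \<Rightarrow> real \<Rightarrow> (complex^8^4) set" where
  "wp l \<alpha> = {M. \<forall>u. bvp_solution l \<alpha> M (\<lambda>x. 0) u \<longrightarrow> (\<forall>x\<in>{-l..l}. u x = 0)}"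

definition Mtilde_minus :: "real \<Rightarrow> real \<Rightarrow> complex^8^4 \<Rightarrow> complex^4^4" where
  "Mtilde_minus l \<alpha> M = Mminus M ** Wmat \<alpha> (-l)"

definition Mtilde_plus :: "real \<Rightarrow> real \<Rightarrow> complex^8^4 \<Rightarrow> complex^4^4" where
  "Mtilde_plus l \<alpha> M = Mplus M ** Wmat \<alpha> l"

definition Mtilde :: "real \<Rightarrow> real \<Rightarrow> complex^8^4 \<Rightarrow> complex^4^4" where
  "Mtilde l \<alpha> M = Mtilde_minus l \<alpha> M + Mtilde_plus l \<alpha> M"

definition Gminus :: "real \<Rightarrow> real \<Rightarrow> complex^8^4 \<Rightarrow> complex^4^4" where
  "Gminus l \<alpha> M = matrix_inv (Mtilde l \<alpha> M) ** Mtilde_minus l \<alpha> M ** Omega ** Lsq"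

definition Gplus :: "real \<Rightarrow> real \<Rightarrow> complex^8^4 \<Rightarrow> complex^4^4" where
  "Gplus l \<alpha> M = matrix_inv (Mtilde l \<alpha> M) ** Mtilde_plus l \<alpha> M ** Omega ** Lsq"

text \<open>
  \<open>v\<^sup>T A z\<close> without complex conjugation (the library's inner product on \<open>complex^4\<close> is the real one).
\<close>

definition bilin :: "complex^4 \<Rightarrow> complex^4^4 \<Rightarrow> complex^4 \<Rightarrow> complex" where
  "bilin v A z = (\<Sum>i\<in>UNIV. v $ i * (A *v z) $ i)"

definition Gfun :: "real \<Rightarrow> real \<Rightarrow> real \<Rightarrow> complex^8^4 \<Rightarrow> real \<Rightarrow> real \<Rightarrow> complex" where
  "Gfun l \<alpha> k M x \<xi> =
     (if x \<le> \<xi>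
      then complex_of_real (\<alpha> / (4 * k)) * bilin (yvec \<alpha> x) (Gplus l \<alpha> M) (yvec \<alpha> \<xi>)
      else - complex_of_real (\<alpha> / (4 * k)) * bilin (yvec \<alpha> x) (Gminus l \<alpha> M) (yvec \<alpha> \<xi>))"

text \<open>Representatives of elements of \<open>L\<^sup>2[-l, l]\<close>.\<close>

definition L2 :: "real \<Rightarrow> (real \<Rightarrow> complex) set" where
  "L2 l = {w \<in> borel_measurable (lebesgue_on {-l..l}).
             integrable (lebesgue_on {-l..l}) (\<lambda>x. (cmod (w x))\<^sup>2)}"

definition Kop :: "real \<Rightarrow> real \<Rightarrow> real \<Rightarrow> complex^8^4 \<Rightarrow> (real \<Rightarrow> complex) \<Rightarrow> real \<Rightarrow> complex" where
  "Kop l \<alpha> k M w x = (LINT \<xi>|lebesgue_on {-l..l}. Gfun l \<alpha> k M x \<xi> * w \<xi>)"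

lemma mat4_nth:
  assumes "p \<in> {1, 2, 3, 4}" "q \<in> {1, 2, 3, 4}"
  shows "mat4 f $ of_nat p $ of_nat q = f p q"
  using assms by (auto simp: mat4_def vector_def)

lemma bdry_nth:
  assumes "n < 4"
  shows "bdry l u $ of_nat (n + 1) = nderiv l n u (-l)"
    and "bdry l u $ of_nat (n + 5) = nderiv l n u l"
proof -
  have "n = 0 \<or> n = 1 \<or> n = 2 \<or> n = 3" using assms by auto
  then show "bdry l u $ of_nat (n + 1) = nderiv l n u (-l)"
    and "bdry l u $ of_nat (n + 5) = nderiv l n u l"
    by (auto simp: bdry_def vector_def)
qed

end

theory Submission
  imports Defs
begin

text \<open>
  Since \<open>G\<^sup>- + G\<^sup>+ = \<Omega>L\<^sup>2\<close>, the operator takes the form \<open>K[w](x) = \<Sum>\<^sub>i y\<^sub>i(x) a\<^sub>i(x)\<close> with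
  \<open>a(x) = \<alpha>/(4k) (G\<^sup>+ J(l) - \<Omega>L\<^sup>2 J(x))\<close>, where \<open>J(x)\<close> is the integral of \<open>y w\<close> over \<open>[-l, x]\<close>
  (variation of constants).  Each summand satisfies
  \<open>b\<^sub>i' = \<omega>\<^sub>i\<alpha> b\<^sub>i - \<alpha>/(4k) \<omega>\<^sub>i w\<close> almost everywhere, and the power sums of the \<open>\<omega>\<^sub>i\<close> vanish for
  the exponents 1, 2, 3 and equal \<open>-4\<close> for the exponent 4: the inhomogeneity cancels from the
  first three derivatives and enters the fourth one as \<open>\<alpha>\<^sup>4/k w\<close>.  The boundary condition reduces
  to the definition of \<open>G\<^sup>+\<close>, because \<open>M\<close> applied to the boundary values is the sum of the
  transformed halves of \<open>M\<close> applied to \<open>a(-l)\<close> and \<open>a(l)\<close>.  The same computation for constant \<open>a\<close>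
  and \<open>w = 0\<close> shows that the matrix inverted in \<open>G\<^sup>\<plusminus>\<close> is invertible.  Uniqueness is
  well-posedness applied to the difference of two solutions.
\<close>

section \<open>Derivatives of indefinite integrals\<close>

lemma integral_diff_initial:
  fixes f :: "real \<Rightarrow> 'a::banach"
  assumes "f integrable_on {a..b}" "a \<le> c" "c \<le> d" "d \<le> b"
  shows "integral {a..d} f - integral {a..c} f = integral {c..d} f"
proof -
  have "f integrable_on {a..d}" by (rule integrable_on_subinterval[OF assms(1)]) (use assms in auto)
  from Henstock_Kurzweil_Integration.integral_combine[OF assms(2,3) this] show ?thesis
    by (simp add: algebra_simps)
qed

text \<open>The cube form of Lebesgue's differentiation theorem,
  \<open>integrable_ccontinuous_explicit\<close>, averages over \<open>{x..x + h}\<close> with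
  \<open>h > 0\<close>, so on the line it yields right derivatives only. Clearing the denominator
  brings the estimate into the shape of \<open>has_derivative_within_alt\<close>.\<close>

lemma right_derivative_integral_negligible:
  fixes f :: "real \<Rightarrow> 'b::euclidean_space"
  assumes "\<And>a b. f integrable_on {a..b}"
  obtains N where "negligible N"
    "\<And>x e. x \<notin> N \<Longrightarrow> 0 < e \<Longrightarrow>
       \<exists>d>0. \<forall>y. x < y \<and> y < x + d \<longrightarrow> norm (integral {x..y} f - (y - x) *\<^sub>R f x) \<le> e * (y - x)"
proof -
  obtain N where N: "negligible N"
    "\<And>x e. \<lbrakk>x \<notin> N; 0 < e\<rbrakk> \<Longrightarrow> \<exists>d>0. \<forall>h. 0 < h \<and> h < d \<longrightarrow>
        norm (integral (cbox x (x + h *\<^sub>R One)) f /\<^sub>R h ^ DIM(real) - f x) < e"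
  proof (rule integrable_ccontinuous_explicit[of f])
    show "f integrable_on cbox c d" for c d using assms by simp
  qed (blast intro: that)
  show thesis
  proof (rule that[OF N(1)])
    fix x e :: real assume "x \<notin> N" "0 < e"
    then obtain d where d: "d > 0" "\<And>h. 0 < h \<Longrightarrow> h < d \<Longrightarrow>
        norm (integral {x..x + h} f /\<^sub>R h - f x) < e"
      using N(2)[of x e] by auto
    have "norm (integral {x..y} f - (y - x) *\<^sub>R f x) \<le> e * (y - x)" if "x < y" "y < x + d" for y
    proof -
      have "integral {x..y} f - (y - x) *\<^sub>R f x = (y - x) *\<^sub>R (integral {x..y} f /\<^sub>R (y - x) - f x)"
        using that by (simp add: scaleR_diff_right)
      then have "norm (integral {x..y} f - (y - x) *\<^sub>R f x)
               = (y - x) * norm (integral {x..y} f /\<^sub>R (y - x) - f x)"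
        using that by simp
      then show ?thesis using d(2)[of "y - x"] that by simp
    qed
    with d(1) show "\<exists>d>0. \<forall>y. x < y \<and> y < x + d \<longrightarrow>
        norm (integral {x..y} f - (y - x) *\<^sub>R f x) \<le> e * (y - x)" by blast
  qed
qed

text \<open>Left differentiability at \<open>x\<close> is right differentiability at
  \<open>- x\<close> of the integral of the reflected function. The exceptional set is therefore the
  one for the function itself together with the mirror image of the one for its reflection.\<close>

lemma indefinite_integral_has_derivative_negligible:
  fixes f :: "real \<Rightarrow> 'b::euclidean_space"
  assumes f: "f integrable_on {a..b}"
  obtains N where "negligible N"
    "\<And>x. x \<in> {a..b} - N \<Longrightarrow>
       ((\<lambda>y. integral {a..y} f) has_vector_derivative f x) (at x within {a..b})"
proof -
  \<comment> \<open>Extension by zero makes the function integrable on every interval, as both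
    one-sided statements require, and leaves integrals inside \<open>{a..b}\<close>
    unchanged.\<close>
  define g where "g x = (if x \<in> {a..b} then f x else 0)" for x
  have "g integrable_on UNIV"
    unfolding g_def using f integrable_restrict_UNIV by blast
  then have g: "g integrable_on {c..d}" for c d
    using integrable_on_subinterval by blast
  then have g': "(\<lambda>x. g (- x)) integrable_on {c..d}" for c d
    using Henstock_Kurzweil_Integration.integrable_reflect_real[where f=g and a="- d" and b="- c"] by simp
  obtain N1 where N1: "negligible N1" "\<And>x e. x \<notin> N1 \<Longrightarrow> 0 < e \<Longrightarrow>
       \<exists>d>0. \<forall>y. x < y \<and> y < x + d \<longrightarrow> norm (integral {x..y} g - (y - x) *\<^sub>R g x) \<le> e * (y - x)"
    by (rule right_derivative_integral_negligible[OF g]) (blast intro: that)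
  obtain N2 where N2: "negligible N2" "\<And>x e. x \<notin> N2 \<Longrightarrow> 0 < e \<Longrightarrow>
       \<exists>d>0. \<forall>y. x < y \<and> y < x + d \<longrightarrow>
         norm (integral {x..y} (\<lambda>x. g (- x)) - (y - x) *\<^sub>R g (- x)) \<le> e * (y - x)"
    by (rule right_derivative_integral_negligible[OF g']) (blast intro: that)
  have "negligible (N1 \<union> uminus ` N2)"
    using N1(1) N2(1)
    by (intro negligible_Un negligible_differentiable_image_negligible) (auto intro!: derivative_intros)
  moreover have "((\<lambda>y. integral {a..y} f) has_vector_derivative f x) (at x within {a..b})"
    if x: "x \<in> {a..b} - (N1 \<union> uminus ` N2)" for x
    unfolding has_vector_derivative_def has_derivative_within_alt
  proof (intro conjI allI impI)
    show "bounded_linear (\<lambda>h. h *\<^sub>R f x)" by (rule bounded_linear_scaleR_left)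
    fix e :: real assume "0 < e"
    have "x \<notin> N1" "- x \<notin> N2" using x by force+
    obtain d1 where d1: "d1 > 0" "\<And>y. x < y \<Longrightarrow> y < x + d1 \<Longrightarrow>
        norm (integral {x..y} g - (y - x) *\<^sub>R g x) \<le> e * (y - x)"
      using N1(2)[OF \<open>x \<notin> N1\<close> \<open>0 < e\<close>] by blast
    obtain d2 where d2: "d2 > 0" "\<And>y. - x < y \<Longrightarrow> y < - x + d2 \<Longrightarrow>
        norm (integral {- x..y} (\<lambda>x. g (- x)) - (y + x) *\<^sub>R g x) \<le> e * (y + x)"
      using N2(2)[OF \<open>- x \<notin> N2\<close> \<open>0 < e\<close>] by auto
    have ig: "integral {c..d} f = integral {c..d} g" if "a \<le> c" "d \<le> b" for c d
      using that by (intro integral_cong) (auto simp: g_def)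
    have gx: "g x = f x" using x by (simp add: g_def)
    have comb: "integral {a..d} f = integral {a..c} f + integral {c..d} f"
      if "a \<le> c" "c \<le> d" "d \<le> b" for c d
      using integral_diff_initial[OF f that] by (simp add: algebra_simps)
    show "\<exists>d>0. \<forall>y\<in>{a..b}. norm (y - x) < d \<longrightarrow>
        norm (integral {a..y} f - integral {a..x} f - (y - x) *\<^sub>R f x) \<le> e * norm (y - x)"
    proof (intro exI conjI ballI impI)
      show "0 < min d1 d2" using d1 d2 by simp
      fix y assume y: "y \<in> {a..b}" "norm (y - x) < min d1 d2"
      consider "x < y" | "y = x" | "y < x" by linarith
      then show "norm (integral {a..y} f - integral {a..x} f - (y - x) *\<^sub>R f x) \<le> e * norm (y - x)"
      proof cases
        case 1
        then show ?thesis using d1(2)[of y] y x comb[of x y] by (simp add: ig gx)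
      next
        case 3
        have "integral {- x..- y} (\<lambda>x. g (- x)) = integral {y..x} f"
          using x y by (simp add: ig)
        then have "norm (integral {y..x} f - (x - y) *\<^sub>R f x) \<le> e * (x - y)"
          using d2(2)[of "- y"] 3 y by (simp add: gx)
        moreover have "integral {a..y} f - integral {a..x} f - (y - x) *\<^sub>R f x
            = - (integral {y..x} f - (x - y) *\<^sub>R f x)"
          using comb[of y x] 3 x y by (simp add: algebra_simps)
        ultimately show ?thesis using 3 by (simp only: norm_minus_cancel) simp
      qed simp
    qed
  qed
  ultimately show thesis by (rule that)
qed

section \<open>Weighted primitives and the exponential convolution\<close>

lemma absolutely_integrable_continuous_mult:
  fixes w \<phi> :: "real \<Rightarrow> complex"
  assumes cont: "continuous_on {a..b} \<phi>" and w: "w absolutely_integrable_on {a..b}"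
  shows "(\<lambda>t. \<phi> t * w t) absolutely_integrable_on {a..b}"
proof (rule absolutely_integrable_bounded_measurable_product[where h = "(*)", OF _ _ _ _ w])
  show "bilinear ((*) :: complex \<Rightarrow> complex \<Rightarrow> complex)"
    by (simp add: bilinear_conv_bounded_bilinear bounded_bilinear_mult)
  show "\<phi> \<in> borel_measurable (lebesgue_on {a..b})"
    by (intro continuous_imp_measurable_on_sets_lebesgue cont) auto
  show "bounded (\<phi> ` {a..b})"
    by (intro compact_imp_bounded compact_continuous_image cont) auto
qed auto

text \<open>Near its zero \<open>x\<close> the weight is at most
  \<open>C * \<bar>y - x\<bar>\<close>, so the integral between \<open>x\<close> and
  \<open>y\<close> is at most \<open>C * \<bar>y - x\<bar>\<close> times the integral of
  \<open>norm (w t)\<close> over that range, and the latter tends to 0. This works at every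
  \<open>x\<close>, whether or not it is a Lebesgue point of \<open>w\<close>.\<close>

lemma has_vector_derivative_weighted_integral_zero:
  fixes w :: "real \<Rightarrow> complex"
  assumes w: "w absolutely_integrable_on {a..b}" and x: "x \<in> {a..b}"
    and cont: "continuous_on {a..b} \<phi>" and "\<phi> x = 0"
    and der: "(\<phi> has_vector_derivative D) (at x within {a..b})"
  shows "((\<lambda>y. integral {a..y} (\<lambda>t. \<phi> t * w t)) has_vector_derivative 0) (at x within {a..b})"
  unfolding has_vector_derivative_def has_derivative_within_alt
proof (intro conjI allI impI)
  show "bounded_linear (\<lambda>h. h *\<^sub>R (0::complex))" by (rule bounded_linear_scaleR_left)
  fix e :: real assume "0 < e"
  \<comment> \<open>The slope \<open>norm D\<close> plus the error 1 obtained from the definition of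
    the derivative with tolerance 1.\<close>
  define C where "C = norm D + 1"
  have "C > 0" unfolding C_def by (simp add: add_nonneg_pos)
  have "\<exists>d>0. \<forall>y\<in>{a..b}. norm (y - x) < d \<longrightarrow> norm (\<phi> y - \<phi> x - (y - x) *\<^sub>R D) \<le> 1 * norm (y - x)"
    using der[unfolded has_vector_derivative_def has_derivative_within_alt, THEN conjunct2, rule_format, of 1]
    by simp
  then obtain d1 where d1: "d1 > 0"
    "\<And>y. y \<in> {a..b} \<Longrightarrow> \<bar>y - x\<bar> < d1 \<Longrightarrow> norm (\<phi> y - (y - x) *\<^sub>R D) \<le> \<bar>y - x\<bar>"
    using \<open>\<phi> x = 0\<close> by auto
  have phi: "norm (\<phi> y) \<le> C * \<bar>y - x\<bar>" if "y \<in> {a..b}" "\<bar>y - x\<bar> < d1" for y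
  proof -
    have "norm (\<phi> y) \<le> norm (\<phi> y - (y - x) *\<^sub>R D) + norm ((y - x) *\<^sub>R D)"
      using norm_triangle_ineq[of "\<phi> y - (y - x) *\<^sub>R D" "(y - x) *\<^sub>R D"] by simp
    also have "norm ((y - x) *\<^sub>R D) = \<bar>y - x\<bar> * norm D" by simp
    finally have "norm (\<phi> y) \<le> norm (\<phi> y - (y - x) *\<^sub>R D) + \<bar>y - x\<bar> * norm D" .
    moreover have "C * \<bar>y - x\<bar> = \<bar>y - x\<bar> * norm D + \<bar>y - x\<bar>"
    proof -
      have "(n + 1) * z = z * n + z" for n z :: real by (simp add: algebra_simps)
      then show ?thesis unfolding C_def .
    qed
    ultimately show ?thesis using d1(2)[OF that] by linarith
  qed
  define Q where "Q y = integral {a..y} (\<lambda>t. norm (w t))" for y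
  have nw: "(\<lambda>t. norm (w t)) integrable_on {a..b}"
    using w by (simp add: absolutely_integrable_on_def)
  have Q: "continuous_on {a..b} Q" unfolding Q_def by (rule indefinite_integral_continuous_1[OF nw])
  have "0 < e / C" using \<open>e > 0\<close> \<open>C > 0\<close> by simp
  from Q[unfolded continuous_on_iff dist_real_def, rule_format, OF x this]
  obtain d2 where d2: "d2 > 0" "\<And>y. y \<in> {a..b} \<Longrightarrow> \<bar>y - x\<bar> < d2 \<Longrightarrow> \<bar>Q y - Q x\<bar> < e / C"
    by blast
  have pw: "(\<lambda>t. \<phi> t * w t) absolutely_integrable_on {a..b}"
    by (rule absolutely_integrable_continuous_mult[OF cont w])
  \<comment> \<open>Here \<open>x\<close> may be either end of \<open>{c..d}\<close>, which covers
    \<open>y\<close> on both sides of \<open>x\<close>.\<close>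
  have key: "norm (integral {c..d} (\<lambda>t. \<phi> t * w t)) \<le> C * (d - c) * (Q d - Q c)"
    if "a \<le> c" "c \<le> d" "d \<le> b" "x = c \<or> x = d" "d - c < d1" for c d
  proof -
    have "norm (integral {c..d} (\<lambda>t. \<phi> t * w t)) \<le> integral {c..d} (\<lambda>t. C * (d - c) * norm (w t))"
    proof (rule integral_norm_bound_integral)
      show "(\<lambda>t. \<phi> t * w t) integrable_on {c..d}"
        by (rule integrable_on_subinterval[where S="{a..b}"])
           (use pw that in \<open>auto simp: absolutely_integrable_on_def\<close>)
      show "(\<lambda>t. C * (d - c) * norm (w t)) integrable_on {c..d}"
        by (rule integrable_on_mult_right, rule integrable_on_subinterval[OF nw]) (use that in auto)
      fix t assume t: "t \<in> {c..d}"
      then have "norm (\<phi> t) \<le> C * \<bar>t - x\<bar>" using that by (intro phi) auto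
      also have "\<dots> \<le> C * (d - c)" using t that \<open>C > 0\<close> by (intro mult_left_mono) auto
      finally show "norm (\<phi> t * w t) \<le> C * (d - c) * norm (w t)"
        by (simp add: norm_mult mult_right_mono)
    qed
    also have "\<dots> = C * (d - c) * integral {c..d} (\<lambda>t. norm (w t))" by simp
    also have "integral {c..d} (\<lambda>t. norm (w t)) = Q d - Q c"
      unfolding Q_def using integral_diff_initial[OF nw that(1-3)] by simp
    finally show ?thesis .
  qed
  have diff: "integral {a..d} (\<lambda>t. \<phi> t * w t) - integral {a..c} (\<lambda>t. \<phi> t * w t)
      = integral {c..d} (\<lambda>t. \<phi> t * w t)" if "a \<le> c" "c \<le> d" "d \<le> b" for c d
    using that pw by (intro integral_diff_initial) (auto simp: absolutely_integrable_on_def)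
  show "\<exists>d>0. \<forall>y\<in>{a..b}. norm (y - x) < d \<longrightarrow>
      norm (integral {a..y} (\<lambda>t. \<phi> t * w t) - integral {a..x} (\<lambda>t. \<phi> t * w t) - (y - x) *\<^sub>R 0)
        \<le> e * norm (y - x)"
  proof (intro exI conjI ballI impI)
    show "0 < min d1 d2" using d1 d2 by simp
    fix y assume y: "y \<in> {a..b}" "norm (y - x) < min d1 d2"
    have Q: "\<bar>Q y - Q x\<bar> \<le> e / C" using d2(2)[of y] y by simp
    have "norm (integral {a..y} (\<lambda>t. \<phi> t * w t) - integral {a..x} (\<lambda>t. \<phi> t * w t))
        \<le> C * \<bar>y - x\<bar> * \<bar>Q y - Q x\<bar>"
    proof (cases "x \<le> y")
      case True
      have "C * (y - x) * (Q y - Q x) \<le> C * (y - x) * \<bar>Q y - Q x\<bar>"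
        using True \<open>C > 0\<close> by (intro mult_left_mono) auto
      then show ?thesis using key[of x y] diff[of x y] True x y by simp
    next
      case False
      have "C * (x - y) * (Q x - Q y) \<le> C * (x - y) * \<bar>Q y - Q x\<bar>"
        using False \<open>C > 0\<close> by (intro mult_left_mono) auto
      then show ?thesis using key[of y x] diff[of y x] False x y by (simp add: norm_minus_commute)
    qed
    also have "\<dots> \<le> C * \<bar>y - x\<bar> * (e / C)"
      using Q \<open>C > 0\<close> by (intro mult_left_mono) auto
    finally show "norm (integral {a..y} (\<lambda>t. \<phi> t * w t) - integral {a..x} (\<lambda>t. \<phi> t * w t) - (y - x) *\<^sub>R 0)
        \<le> e * norm (y - x)" using \<open>C > 0\<close> by (simp add: mult.commute)
  qed
qed

lemma has_vector_derivative_iff_tendsto: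
  "(f has_vector_derivative D) (at x within S) \<longleftrightarrow>
     ((\<lambda>y. (f y - f x) /\<^sub>R (y - x)) \<longlongrightarrow> D) (at x within S)"
proof -
  have "norm (f y - f x - (y - x) *\<^sub>R D) / norm (y - x) = norm ((f y - f x) /\<^sub>R (y - x) - D)" if "y \<noteq> x" for y
  proof -
    have "(f y - f x) /\<^sub>R (y - x) - D = (f y - f x - (y - x) *\<^sub>R D) /\<^sub>R (y - x)"
      using that by (simp add: scaleR_diff_right)
    then show ?thesis by (simp add: divide_inverse mult.commute)
  qed
  then have "((\<lambda>y. norm (f y - f x - (y - x) *\<^sub>R D) / norm (y - x)) \<longlongrightarrow> 0) (at x within S) \<longleftrightarrow>
      ((\<lambda>y. norm ((f y - f x) /\<^sub>R (y - x) - D)) \<longlongrightarrow> 0) (at x within S)"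
    by (intro filterlim_cong) (auto simp: eventually_at_filter)
  then show ?thesis
    unfolding has_vector_derivative_def has_derivative_iff_norm
    by (simp add: bounded_linear_scaleR_left tendsto_norm_zero_iff LIM_zero_iff)
qed

text \<open>At a zero of \<open>\<psi>\<close> the difference quotient of the product is that of
  \<open>\<psi>\<close> times \<open>V y\<close>, so continuity of \<open>V\<close> at
  \<open>x\<close> suffices. This is what allows \<open>V\<close> to be a primitive of a
  discontinuous function.\<close>

lemma has_vector_derivative_mult_zero:
  fixes \<psi> V :: "real \<Rightarrow> complex"
  assumes \<psi>: "(\<psi> has_vector_derivative D) (at x within S)" "\<psi> x = 0"
    and V: "continuous (at x within S) V"
  shows "((\<lambda>y. \<psi> y * V y) has_vector_derivative D * V x) (at x within S)"
proof -
  have "((\<lambda>y. (\<psi> y - \<psi> x) /\<^sub>R (y - x)) \<longlongrightarrow> D) (at x within S)"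
    using \<psi>(1) by (simp add: has_vector_derivative_iff_tendsto)
  then have "((\<lambda>y. ((\<psi> y - \<psi> x) /\<^sub>R (y - x)) * V y) \<longlongrightarrow> D * V x) (at x within S)"
    using V by (intro tendsto_mult) (simp_all add: continuous_within)
  then show ?thesis
    using \<psi>(2) by (simp add: has_vector_derivative_iff_tendsto)
qed

lemma has_vector_derivative_exp_mult:
  "((\<lambda>y. exp (c * complex_of_real y)) has_vector_derivative c * exp (c * complex_of_real x)) (at x within S)"
  by (rule has_vector_derivative_real_field[THEN has_vector_derivative_at_within, of "\<lambda>z. exp (c * z)", unfolded o_def])
     (auto intro!: derivative_eq_intros)

text \<open>
  The function \<open>E\<close> solves \<open>E' = c E + w\<close>, but \<open>w\<close> is not continuous; subtracting the indefinite
  integral of \<open>w\<close> leaves a function that is differentiable everywhere.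
\<close>

lemma has_vector_derivative_exp_convolution:
  fixes w :: "real \<Rightarrow> complex" and a b x :: real and c :: complex
  assumes w: "w absolutely_integrable_on {a..b}" and x: "x \<in> {a..b}"
  defines "E \<equiv> \<lambda>y. exp (c * complex_of_real y) * integral {a..y} (\<lambda>t. exp (- c * complex_of_real t) * w t)"
  shows "((\<lambda>y. E y - integral {a..y} w) has_vector_derivative c * E x) (at x within {a..b})"
proof -
  \<comment> \<open>The exponential weight is compared with its value at the fixed point
    \<open>x\<close>. The deviation \<open>\<phi>\<close> vanishes there, so its primitive
    \<open>P\<close> has derivative 0 at \<open>x\<close>. What remains of \<open>E - V\<close> is a
    multiple of \<open>V\<close> whose factor also vanishes at \<open>x\<close>.\<close>
  define \<phi> where "\<phi> t = exp (- c * complex_of_real t) - exp (- c * complex_of_real x)" for t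
  define P where "P y = integral {a..y} (\<lambda>t. \<phi> t * w t)" for y
  define V where "V y = integral {a..y} w" for y
  have wi: "w integrable_on {a..b}" using w by (simp add: absolutely_integrable_on_def)
  have cont: "continuous_on {a..b} \<phi>" unfolding \<phi>_def by (intro continuous_intros)
  have phw: "(\<lambda>t. \<phi> t * w t) integrable_on {a..b}"
    by (rule absolutely_integrable_continuous_mult[OF cont w, THEN absolutely_integrable_on_def[THEN iffD1, THEN conjunct1]])
  have "(P has_vector_derivative 0) (at x within {a..b})"
    unfolding P_def
  proof (rule has_vector_derivative_weighted_integral_zero[OF w x cont])
    show "(\<phi> has_vector_derivative - c * exp (- c * complex_of_real x)) (at x within {a..b})"
      unfolding \<phi>_def using has_vector_derivative_diff[OF has_vector_derivative_exp_mult[of "- c" x "{a..b}"] has_vector_derivative_const]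
      by simp
  qed (simp add: \<phi>_def)
  then have P': "((\<lambda>y. exp (c * complex_of_real y) * P y) has_vector_derivative
      exp (c * complex_of_real x) * 0 + c * exp (c * complex_of_real x) * P x) (at x within {a..b})"
    by (intro has_vector_derivative_mult has_vector_derivative_exp_mult)
  have V': "((\<lambda>y. (exp (c * complex_of_real y) * exp (- c * complex_of_real x) - 1) * V y) has_vector_derivative
      c * exp (c * complex_of_real x) * exp (- c * complex_of_real x) * V x) (at x within {a..b})"
  proof (rule has_vector_derivative_mult_zero)
    show "((\<lambda>y. exp (c * complex_of_real y) * exp (- c * complex_of_real x) - 1) has_vector_derivative
      c * exp (c * complex_of_real x) * exp (- c * complex_of_real x)) (at x within {a..b})"
      using has_vector_derivative_diff[OF has_vector_derivative_mult_left[OF has_vector_derivative_exp_mult[of c x "{a..b}"]] has_vector_derivative_const]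
      by simp
    show "exp (c * complex_of_real x) * exp (- c * complex_of_real x) - 1 = 0" by (simp add: exp_minus)
    show "continuous (at x within {a..b}) V"
      using indefinite_integral_continuous_1[OF wi] x unfolding V_def continuous_on_eq_continuous_within by blast
  qed
  have E: "E y = exp (c * complex_of_real y) * (P y + exp (- c * complex_of_real x) * V y)"
    if "y \<in> {a..b}" for y
  proof -
    have "integral {a..y} (\<lambda>t. exp (- c * complex_of_real t) * w t)
        = integral {a..y} (\<lambda>t. \<phi> t * w t + exp (- c * complex_of_real x) * w t)"
      by (simp add: \<phi>_def algebra_simps)
    also have "\<dots> = P y + exp (- c * complex_of_real x) * V y"
      using that unfolding P_def V_def
      by (subst integral_add) (auto intro!: integrable_on_mult_right integrable_on_subinterval[OF wi] integrable_on_subinterval[OF phw])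
    finally show ?thesis by (simp add: E_def)
  qed
  have "exp (c * complex_of_real x) * 0 + c * exp (c * complex_of_real x) * P x
      + c * exp (c * complex_of_real x) * exp (- c * complex_of_real x) * V x = c * E x"
    using E[OF x] by (simp add: algebra_simps)
  with has_vector_derivative_add[OF P' V']
  have "((\<lambda>y. exp (c * complex_of_real y) * P y + (exp (c * complex_of_real y) * exp (- c * complex_of_real x) - 1) * V y)
      has_vector_derivative c * E x) (at x within {a..b})" by simp
  moreover have "E y - V y = exp (c * complex_of_real y) * P y
      + (exp (c * complex_of_real y) * exp (- c * complex_of_real x) - 1) * V y" if "y \<in> {a..b}" for y
    unfolding E[OF that] by (simp add: algebra_simps)
  ultimately show ?thesis
    unfolding V_def[symmetric] by (rule has_vector_derivative_transform[OF x, rotated])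
qed

section \<open>Absolute continuity and solutions of the differential equation\<close>

text \<open>Summed over a family of intervals, the bound is \<open>L\<close> times the total length
  plus at most \<open>\<eta>\<close> times the integral of \<open>g\<close> over
  \<open>{a..b}\<close>. First \<open>\<eta>\<close> is chosen to make the second part small, which
  fixes \<open>L\<close>; then the admissible total length is chosen in terms of
  \<open>L\<close>.\<close>

lemma abs_continuous_funI:
  fixes F :: "real \<Rightarrow> complex" and g :: "real \<Rightarrow> real"
  assumes g: "g integrable_on {a..b}" "\<And>x. x \<in> {a..b} \<Longrightarrow> 0 \<le> g x"
    and F: "\<And>\<eta>. \<eta> > 0 \<Longrightarrow> \<exists>L. \<forall>s t. a \<le> s \<and> s < t \<and> t \<le> b \<longrightarrow>
              cmod (F t - F s) \<le> L * (t - s) + \<eta> * integral {s..t} g"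
  shows "abs_continuous_fun a b F"
  unfolding abs_continuous_fun_def
proof (intro allI impI)
  fix e :: real assume "0 < e"
  define I where "I = integral {a..b} g"
  have "0 \<le> I" unfolding I_def using g by (intro integral_nonneg) auto
  define \<eta> where "\<eta> = e / (2 * (I + 1))"
  have "\<eta> > 0" using \<open>0 < e\<close> \<open>0 \<le> I\<close> by (simp add: \<eta>_def)
  have "\<eta> * I < e / 2"
    using \<open>0 < e\<close> \<open>0 \<le> I\<close> by (simp add: \<eta>_def field_simps)
  obtain L where L: "\<And>s t. a \<le> s \<Longrightarrow> s < t \<Longrightarrow> t \<le> b \<Longrightarrow>
      cmod (F t - F s) \<le> L * (t - s) + \<eta> * integral {s..t} g"
    using F[OF \<open>\<eta> > 0\<close>] by blast
  \<comment> \<open>\<open>\<bar>L\<bar> + 1\<close> serves as a positive upper bound of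
    \<open>L\<close>, whose sign is unknown.\<close>
  define \<delta> where "\<delta> = e / (2 * (\<bar>L\<bar> + 1))"
  have "\<delta> > 0" using \<open>0 < e\<close> by (simp add: \<delta>_def add_nonneg_pos)
  have "(\<Sum>(s, t)\<in>P. cmod (F t - F s)) < e"
    if P: "finite P" "\<forall>(s, t)\<in>P. a \<le> s \<and> s < t \<and> t \<le> b"
      "pairwise (\<lambda>I J. disjnt {fst I<..<snd I} {fst J<..<snd J}) P"
      "(\<Sum>(s, t)\<in>P. t - s) < \<delta>" for P :: "(real \<times> real) set"
  proof -
    have sub: "{fst p..snd p} \<subseteq> {a..b}" if "p \<in> P" for p using P(2) that by fastforce
    \<comment> \<open>Intervals with disjoint interiors meet in end points only, so their integrals
      add up to the integral over the union, which is at most \<open>I\<close> because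
      \<open>g\<close> is nonnegative.\<close>
    have "(g has_integral (\<Sum>p\<in>P. integral {fst p..snd p} g)) (\<Union>p\<in>P. {fst p..snd p})"
    proof (rule has_integral_UN[OF \<open>finite P\<close>])
      show "(g has_integral integral {fst p..snd p} g) {fst p..snd p}" if "p \<in> P" for p
        using integrable_on_subinterval[OF g(1) sub[OF that]] by (rule integrable_integral)
      have "negligible ({fst p..snd p} \<inter> {fst q..snd q})"
        if "disjnt {fst p<..<snd p} {fst q<..<snd q}" for p q :: "real \<times> real"
      proof (rule negligible_subset)
        show "negligible {fst p, snd p, fst q, snd q}" by simp
        show "{fst p..snd p} \<inter> {fst q..snd q} \<subseteq> {fst p, snd p, fst q, snd q}"
        proof (rule ccontr)
          assume "\<not> ?thesis"
          then obtain y where "y \<in> {fst p..snd p}" "y \<in> {fst q..snd q}" "y \<notin> {fst p, snd p, fst q, snd q}"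
            by blast
          then have "y \<in> {fst p<..<snd p}" "y \<in> {fst q<..<snd q}" by auto
          with that show False by (auto simp: disjnt_def)
        qed
      qed
      then show "pairwise (\<lambda>p q. negligible ({fst p..snd p} \<inter> {fst q..snd q})) P"
        using P(3) unfolding pairwise_def by blast
    qed
    moreover have "(\<Union>p\<in>P. {fst p..snd p}) \<subseteq> {a..b}" using sub by (rule UN_least)
    ultimately have "(\<Sum>p\<in>P. integral {fst p..snd p} g) \<le> I"
      unfolding I_def using integrable_integral[OF g(1)] g(2) by (intro has_integral_subset_le) auto
    then have "\<eta> * (\<Sum>p\<in>P. integral {fst p..snd p} g) < e / 2"
      using \<open>\<eta> * I < e / 2\<close> \<open>\<eta> > 0\<close> by (meson le_less_trans mult_left_mono less_imp_le)
    moreover have "L * (\<Sum>p\<in>P. snd p - fst p) \<le> e / 2"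
    proof -
      have *: "0 \<le> (\<Sum>p\<in>P. snd p - fst p)" using P(2) by (intro sum_nonneg) fastforce
      then have "L * (\<Sum>p\<in>P. snd p - fst p) \<le> (\<bar>L\<bar> + 1) * (\<Sum>p\<in>P. snd p - fst p)"
        by (intro mult_right_mono) auto
      also have "\<dots> \<le> (\<bar>L\<bar> + 1) * \<delta>"
        using P(4) by (intro mult_left_mono) (auto simp: case_prod_unfold)
      also have "\<dots> = e / 2" by (simp add: \<delta>_def field_simps add_nonneg_eq_0_iff)
      finally show ?thesis .
    qed
    moreover have "(\<Sum>(s, t)\<in>P. cmod (F t - F s))
        \<le> (\<Sum>p\<in>P. L * (snd p - fst p) + \<eta> * integral {fst p..snd p} g)"
      using P(2) by (auto simp: case_prod_unfold intro!: sum_mono L)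
    ultimately show ?thesis
      by (simp add: sum.distrib sum_distrib_left[symmetric])
  qed
  with \<open>\<delta> > 0\<close> show "\<exists>\<delta>>0. \<forall>P :: (real \<times> real) set.
        finite P \<and> (\<forall>(s, t)\<in>P. a \<le> s \<and> s < t \<and> t \<le> b) \<and>
        pairwise (\<lambda>I J. disjnt {fst I<..<snd I} {fst J<..<snd J}) P \<and>
        (\<Sum>(s, t)\<in>P. t - s) < \<delta>
        \<longrightarrow> (\<Sum>(s, t)\<in>P. cmod (F t - F s)) < e"
    by blast
qed

lemma abs_continuous_fun_diff:
  assumes "abs_continuous_fun a b F" "abs_continuous_fun a b G"
  shows "abs_continuous_fun a b (\<lambda>x. F x - G x)"
  unfolding abs_continuous_fun_def
proof (intro allI impI)
  fix e :: real assume "0 < e"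
  then have "0 < e / 2" by simp
  from assms(1)[unfolded abs_continuous_fun_def, rule_format, OF this]
  obtain d1 where d1: "d1 > 0" "\<And>P :: (real \<times> real) set. finite P \<Longrightarrow> (\<forall>(s, t)\<in>P. a \<le> s \<and> s < t \<and> t \<le> b) \<Longrightarrow>
        pairwise (\<lambda>I J. disjnt {fst I<..<snd I} {fst J<..<snd J}) P \<Longrightarrow>
        (\<Sum>(s, t)\<in>P. t - s) < d1 \<Longrightarrow> (\<Sum>(s, t)\<in>P. cmod (F t - F s)) < e / 2" by blast
  from assms(2)[unfolded abs_continuous_fun_def, rule_format, OF \<open>0 < e / 2\<close>]
  obtain d2 where d2: "d2 > 0" "\<And>P :: (real \<times> real) set. finite P \<Longrightarrow> (\<forall>(s, t)\<in>P. a \<le> s \<and> s < t \<and> t \<le> b) \<Longrightarrow>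
        pairwise (\<lambda>I J. disjnt {fst I<..<snd I} {fst J<..<snd J}) P \<Longrightarrow>
        (\<Sum>(s, t)\<in>P. t - s) < d2 \<Longrightarrow> (\<Sum>(s, t)\<in>P. cmod (G t - G s)) < e / 2" by blast
  have "(\<Sum>(s, t)\<in>P. cmod ((F t - G t) - (F s - G s))) < e"
    if P: "finite P" "\<forall>(s, t)\<in>P. a \<le> s \<and> s < t \<and> t \<le> b"
      "pairwise (\<lambda>I J. disjnt {fst I<..<snd I} {fst J<..<snd J}) P"
      "(\<Sum>(s, t)\<in>P. t - s) < min d1 d2" for P :: "(real \<times> real) set"
  proof -
    have "cmod ((F t - G t) - (F s - G s)) \<le> cmod (F t - F s) + cmod (G t - G s)" for s t
      using norm_triangle_ineq4[of "F t - F s" "G t - G s"] by (simp add: algebra_simps)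
    then have "(\<Sum>(s, t)\<in>P. cmod ((F t - G t) - (F s - G s)))
        \<le> (\<Sum>(s, t)\<in>P. cmod (F t - F s)) + (\<Sum>(s, t)\<in>P. cmod (G t - G s))"
      by (auto simp: case_prod_unfold sum.distrib[symmetric] intro!: sum_mono)
    then show ?thesis using d1(2)[OF P(1-3)] d2(2)[OF P(1-3)] P(4) by simp
  qed
  then show "\<exists>\<delta>>0. \<forall>P :: (real \<times> real) set.
        finite P \<and> (\<forall>(s, t)\<in>P. a \<le> s \<and> s < t \<and> t \<le> b) \<and>
        pairwise (\<lambda>I J. disjnt {fst I<..<snd I} {fst J<..<snd J}) P \<and>
        (\<Sum>(s, t)\<in>P. t - s) < \<delta>
        \<longrightarrow> (\<Sum>(s, t)\<in>P. cmod ((F t - G t) - (F s - G s))) < e"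
    using d1(1) d2(1) by (intro exI[of _ "min d1 d2"]) auto
qed

text \<open>Derivatives within a nondegenerate closed interval are unique, so any chain of
  derivatives starting at \<open>u\<close> on the interval is the chain of iterated derivatives. The
  induction needs agreement on the whole interval before differentiating once more.\<close>

lemma nderiv_eqI:
  assumes "0 < l"
    and "\<And>x. x \<in> {-l..l} \<Longrightarrow> D 0 x = u x"
    and der: "\<And>m x. m < n \<Longrightarrow> x \<in> {-l..l} \<Longrightarrow> (D m has_vector_derivative D (Suc m) x) (at x within {-l..l})"
    and "x \<in> {-l..l}"
  shows "nderiv l n u x = D n x"
  using der \<open>x \<in> {-l..l}\<close>
proof (induction n arbitrary: x)
  case 0
  then show ?case using assms by (simp add: nderiv_def)
next
  case (Suc n)
  have "(nderiv l n u has_vector_derivative D (Suc n) x) (at x within {-l..l})"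
    using Suc by (intro has_vector_derivative_transform[OF Suc.prems(2) _ Suc.prems(1)]) auto
  then have "vector_derivative (nderiv l n u) (at x within {-l..l}) = D (Suc n) x"
    using assms(1) Suc.prems(2) by (intro vector_derivative_within_closed_interval) auto
  then show ?case by (simp add: nderiv_def)
qed

text \<open>A criterion for explicit candidates: by \<open>nderiv_eqI\<close> the functions
  \<open>D n\<close> agree with the iterated derivatives on the interval, and every clause of
  \<open>ode_solution\<close> depends only on values there. The set \<open>N\<close> is the
  exceptional null set of the equation.\<close>

lemma ode_solutionI:
  assumes "0 < l"
    and u: "\<And>x. x \<in> {-l..l} \<Longrightarrow> D 0 x = u x"
    and der: "\<And>m x. m < 3 \<Longrightarrow> x \<in> {-l..l} \<Longrightarrow> (D m has_vector_derivative D (Suc m) x) (at x within {-l..l})"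
    and cont: "continuous_on {-l..l} (D 3)"
    and AC: "abs_continuous_fun (-l) l (D 3)"
    and N: "negligible N" "\<And>x. x \<in> {-l..l} - N \<Longrightarrow>
       (D 3 has_vector_derivative (f x - complex_of_real (\<alpha>^4) * u x)) (at x within {-l..l})"
  shows "ode_solution l \<alpha> f u"
proof -
  have eq: "nderiv l n u x = D n x" if "n \<le> 3" "x \<in> {-l..l}" for n x
    using that by (intro nderiv_eqI[where D = D and u = u, OF \<open>0 < l\<close> u]) (auto intro!: der)
  have "nderiv l n u differentiable_on {-l..l}" if "n < 3" for n
    unfolding differentiable_on_def
  proof
    fix x assume x: "x \<in> {-l..l}"
    have "(nderiv l n u has_vector_derivative D (Suc n) x) (at x within {-l..l})"
      using eq that by (intro has_vector_derivative_transform[OF x _ der[OF that x]]) auto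
    then show "nderiv l n u differentiable at x within {-l..l}"
      by (rule differentiableI_vector)
  qed
  moreover have "continuous_on {-l..l} (nderiv l 3 u)"
    using cont by (rule continuous_on_eq) (simp add: eq)
  moreover have "abs_continuous_fun (-l) l (nderiv l 3 u)"
  proof -
    have "(\<Sum>(s, t)\<in>P. cmod (nderiv l 3 u t - nderiv l 3 u s)) = (\<Sum>(s, t)\<in>P. cmod (D 3 t - D 3 s))"
      if "\<forall>(s, t)\<in>P. - l \<le> s \<and> s < t \<and> t \<le> l" for P
      using that by (intro sum.cong) (auto simp: eq)
    then show ?thesis using AC unfolding abs_continuous_fun_def
      by (simp cong: conj_cong)
  qed
  moreover have "AE x in lebesgue_on {-l..l}.
        \<exists>d. (nderiv l 3 u has_vector_derivative d) (at x within {-l..l}) \<and>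
            d + complex_of_real (\<alpha>^4) * u x = f x"
  proof (subst AE_restrict_space_iff)
    show "AE x in lebesgue. x \<in> {-l..l} \<longrightarrow>
        (\<exists>d. (nderiv l 3 u has_vector_derivative d) (at x within {-l..l}) \<and>
            d + complex_of_real (\<alpha>^4) * u x = f x)"
    proof (rule AE_I'[of N])
      show "N \<in> null_sets lebesgue" using N(1) by (simp add: negligible_iff_null_sets)
      show "{x \<in> space lebesgue. \<not> (x \<in> {-l..l} \<longrightarrow>
        (\<exists>d. (nderiv l 3 u has_vector_derivative d) (at x within {-l..l}) \<and>
            d + complex_of_real (\<alpha>^4) * u x = f x))} \<subseteq> N"
      proof (rule ccontr)
        assume "\<not> ?thesis"
        then obtain x where x: "x \<in> {-l..l}" "x \<notin> N" and no:
           "\<not> (\<exists>d. (nderiv l 3 u has_vector_derivative d) (at x within {-l..l}) \<and>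
            d + complex_of_real (\<alpha>^4) * u x = f x)" by blast
        have "(nderiv l 3 u has_vector_derivative (f x - complex_of_real (\<alpha>^4) * u x)) (at x within {-l..l})"
          by (rule has_vector_derivative_transform[OF x(1) _ N(2)]) (use x eq in auto)
        with no show False by fastforce
      qed
    qed
  qed auto
  ultimately show ?thesis unfolding ode_solution_def C3_on_def by blast
qed

section \<open>Differences of solutions\<close>

lemma nderiv_has_vector_derivative:
  assumes "C3_on l u" "n < 3" "x \<in> {-l..l}"
  shows "(nderiv l n u has_vector_derivative nderiv l (Suc n) u x) (at x within {-l..l})"
proof -
  have "nderiv l n u differentiable at x within {-l..l}"
    using assms by (auto simp: C3_on_def differentiable_on_def)
  then show ?thesis by (simp add: vector_derivative_works nderiv_def)
qed

lemma nderiv_diff: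
  assumes "0 < l" "C3_on l u" "C3_on l v" "n \<le> 3" "x \<in> {-l..l}"
  shows "nderiv l n (\<lambda>x. u x - v x) x = nderiv l n u x - nderiv l n v x"
  by (rule nderiv_eqI[where D = "\<lambda>n x. nderiv l n u x - nderiv l n v x"])
     (use assms in \<open>auto simp: nderiv_def[of l 0] intro!: has_vector_derivative_diff nderiv_has_vector_derivative\<close>)

lemma ode_solution_diff:
  assumes "0 < l" and u: "ode_solution l \<alpha> f u" and v: "ode_solution l \<alpha> f v"
  shows "ode_solution l \<alpha> (\<lambda>x. 0) (\<lambda>x. u x - v x)"
proof -
  have C: "C3_on l u" "C3_on l v" using u v by (auto simp: ode_solution_def)
  have "AE x in lebesgue_on {-l..l}.
        \<exists>d. ((\<lambda>x. nderiv l 3 u x - nderiv l 3 v x) has_vector_derivative d) (at x within {-l..l}) \<and>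
            d + complex_of_real (\<alpha>^4) * (u x - v x) = 0"
  proof -
    have "AE x in lebesgue_on {-l..l}. \<exists>d. (nderiv l 3 u has_vector_derivative d) (at x within {-l..l}) \<and>
            d + complex_of_real (\<alpha>^4) * u x = f x"
      and "AE x in lebesgue_on {-l..l}. \<exists>d. (nderiv l 3 v has_vector_derivative d) (at x within {-l..l}) \<and>
            d + complex_of_real (\<alpha>^4) * v x = f x"
      using u v by (simp_all add: ode_solution_def)
    then show ?thesis
    proof eventually_elim
      case (elim x)
      then obtain d d' where
        d: "(nderiv l 3 u has_vector_derivative d) (at x within {-l..l})" "d + complex_of_real (\<alpha>^4) * u x = f x"
        "(nderiv l 3 v has_vector_derivative d') (at x within {-l..l})" "d' + complex_of_real (\<alpha>^4) * v x = f x"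
        by blast
      then have "(d - d') + complex_of_real (\<alpha>^4) * (u x - v x) = 0"
        by (simp add: algebra_simps)
      with has_vector_derivative_diff[OF d(1,3)] show ?case by blast
    qed
  qed
  then have "AE x in lebesgue. x \<in> {-l..l} \<longrightarrow> (\<exists>d. ((\<lambda>x. nderiv l 3 u x - nderiv l 3 v x) has_vector_derivative d) (at x within {-l..l}) \<and>
            d + complex_of_real (\<alpha>^4) * (u x - v x) = 0)"
    by (subst (asm) AE_restrict_space_iff) auto
  then obtain N where N: "N \<in> null_sets lebesgue" "\<And>x. x \<in> {-l..l} - N \<Longrightarrow>
      \<exists>d. ((\<lambda>x. nderiv l 3 u x - nderiv l 3 v x) has_vector_derivative d) (at x within {-l..l}) \<and>
            d + complex_of_real (\<alpha>^4) * (u x - v x) = 0"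
    by (elim AE_E3) auto
  show ?thesis
  proof (rule ode_solutionI[where D = "\<lambda>n x. nderiv l n u x - nderiv l n v x" and N = N])
    show "0 < l" by fact
    show "nderiv l 0 u x - nderiv l 0 v x = u x - v x" for x by (simp add: nderiv_def)
    show "((\<lambda>x. nderiv l m u x - nderiv l m v x) has_vector_derivative nderiv l (Suc m) u x - nderiv l (Suc m) v x)
        (at x within {-l..l})" if "m < 3" "x \<in> {-l..l}" for m x
      using that C by (intro has_vector_derivative_diff nderiv_has_vector_derivative)
    show "continuous_on {-l..l} (\<lambda>x. nderiv l 3 u x - nderiv l 3 v x)"
      using C unfolding C3_on_def by (intro continuous_on_diff) auto
    show "abs_continuous_fun (-l) l (\<lambda>x. nderiv l 3 u x - nderiv l 3 v x)"
      using u v unfolding ode_solution_def by (intro abs_continuous_fun_diff) auto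
    show "negligible N" using N(1) by (simp add: negligible_iff_null_sets)
    show "((\<lambda>x. nderiv l 3 u x - nderiv l 3 v x) has_vector_derivative 0 - complex_of_real (\<alpha>^4) * (u x - v x))
        (at x within {-l..l})" if "x \<in> {-l..l} - N" for x
    proof -
      from N(2)[OF that] obtain d where "((\<lambda>x. nderiv l 3 u x - nderiv l 3 v x) has_vector_derivative d) (at x within {-l..l})"
        and "d + complex_of_real (\<alpha>^4) * (u x - v x) = 0" by blast
      moreover from this(2) have "d = 0 - complex_of_real (\<alpha>^4) * (u x - v x)"
        by (simp add: eq_neg_iff_add_eq_0)
      ultimately show ?thesis by metis
    qed
  qed
qed

section \<open>The matrices of the problem\<close>

lemma exhaust_8:
  fixes x :: 8
  shows "x = 1 \<or> x = 2 \<or> x = 3 \<or> x = 4 \<or> x = 5 \<or> x = 6 \<or> x = 7 \<or> x = 8"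
proof (induct x)
  case (of_int z)
  \<comment> \<open>Elements of the index type are represented by 0 to 7, and the index written
    \<open>8\<close> is 0.\<close>
  then have "z = 0 \<or> z = 1 \<or> z = 2 \<or> z = 3 \<or> z = 4 \<or> z = 5 \<or> z = 6 \<or> z = 7" by fastforce
  then show ?case by auto
qed

lemma sum_8: "sum f (UNIV :: 8 set) = f 1 + f 2 + f 3 + f 4 + f 5 + f 6 + f 7 + f 8"
proof -
  have "UNIV = {1, 2, 3, 4, 5, 6, 7, 8 :: 8}" using exhaust_8 by blast
  then have "sum f (UNIV :: 8 set) = sum f {1, 2, 3, 4, 5, 6, 7, 8}" by (rule arg_cong)
  also have "\<dots> = f 1 + f 2 + f 3 + f 4 + f 5 + f 6 + f 7 + f 8" by (simp add: add.assoc)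
  finally show ?thesis .
qed

lemma mat4_nth_4:
  "mat4 f $ 1 $ 1 = f 1 1" "mat4 f $ 1 $ 2 = f 1 2" "mat4 f $ 1 $ 3 = f 1 3" "mat4 f $ 1 $ 4 = f 1 4"
  "mat4 f $ 2 $ 1 = f 2 1" "mat4 f $ 2 $ 2 = f 2 2" "mat4 f $ 2 $ 3 = f 2 3" "mat4 f $ 2 $ 4 = f 2 4"
  "mat4 f $ 3 $ 1 = f 3 1" "mat4 f $ 3 $ 2 = f 3 2" "mat4 f $ 3 $ 3 = f 3 3" "mat4 f $ 3 $ 4 = f 3 4"
  "mat4 f $ 4 $ 1 = f 4 1" "mat4 f $ 4 $ 2 = f 4 2" "mat4 f $ 4 $ 3 = f 4 3" "mat4 f $ 4 $ 4 = f 4 4"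
  by (simp_all add: mat4_def vector_def)

lemma vector_nth_4:
  "(vector [a, b, c, d] :: 'a::zero^4) $ 1 = a" "(vector [a, b, c, d] :: 'a::zero^4) $ 2 = b"
  "(vector [a, b, c, d] :: 'a::zero^4) $ 3 = c" "(vector [a, b, c, d] :: 'a::zero^4) $ 4 = d"
  by (simp_all add: vector_def)

lemma vector_nth_8:
  "(vector [a, b, c, d, e, f, g, h] :: 'a::zero^8) $ 1 = a" "(vector [a, b, c, d, e, f, g, h] :: 'a::zero^8) $ 2 = b"
  "(vector [a, b, c, d, e, f, g, h] :: 'a::zero^8) $ 3 = c" "(vector [a, b, c, d, e, f, g, h] :: 'a::zero^8) $ 4 = d"
  "(vector [a, b, c, d, e, f, g, h] :: 'a::zero^8) $ 5 = e" "(vector [a, b, c, d, e, f, g, h] :: 'a::zero^8) $ 6 = f"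
  "(vector [a, b, c, d, e, f, g, h] :: 'a::zero^8) $ 7 = g" "(vector [a, b, c, d, e, f, g, h] :: 'a::zero^8) $ 8 = h"
  by (simp_all add: vector_def)

lemma matrix_vector_mult_halves:
  "M *v vector [a, b, c, d, e, f, g, h] = Mminus M *v vector [a, b, c, d] + Mplus M *v vector [e, f, g, h]"
  by (simp add: vec_eq_iff forall_4 matrix_vector_mult_def sum_8 sum_4 vector_nth_4 vector_nth_8
      Mminus_def Mplus_def mat4_nth_4)

text \<open>Raising the index by one turns the argument by \<open>pi / 2\<close>. All the
  \<open>omega j\<close> are thus expressed through \<open>omega 1\<close>, of which only the square
  \<open>\<i>\<close> matters later.\<close>

lemma omega_Suc: "omega (j + 1) = \<i> * omega j"
proof -
  have "pi / 4 * (2 * real_of_int (j + 1) - 1) = pi / 2 + pi / 4 * (2 * real_of_int j - 1)"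
    by (simp add: field_simps)
  then have "omega (j + 1) = cis (pi / 2 + pi / 4 * (2 * real_of_int j - 1))"
    by (simp only: omega_def cis_conv_exp)
  also have "\<dots> = \<i> * cis (pi / 4 * (2 * real_of_int j - 1))"
    by (simp only: cis_mult[symmetric] cis_pi_half)
  finally show ?thesis by (simp only: omega_def cis_conv_exp)
qed

lemma omega_simps: "omega 2 = \<i> * omega 1" "omega 3 = - omega 1" "omega 4 = - (\<i> * omega 1)"
  using omega_Suc[of 1] omega_Suc[of 2] omega_Suc[of 3] by simp_all

lemma omega_1_square: "omega 1 * omega 1 = \<i>"
proof -
  have "omega 1 = cis (pi / 4)" by (simp add: omega_def cis_conv_exp)
  then show ?thesis by (simp add: cis_mult)
qed

text \<open>The roots indexed by the type \<open>4\<close>, for sums over \<open>UNIV\<close> and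
  cyclic shifts of the index. Reading them off the diagonal of \<open>Omega\<close> avoids
  converting indices to integers.\<close>

definition Om :: "4 \<Rightarrow> complex" where "Om i = Omega $ i $ i"

lemma Om_simps: "Om 1 = omega 1" "Om 2 = \<i> * omega 1" "Om 3 = - omega 1" "Om 4 = - (\<i> * omega 1)"
  by (simp_all add: Om_def Omega_def mat4_nth_4 omega_simps)

lemma numerals_mod_4: "(5 :: 4) = 1" "(6 :: 4) = 2"
  by simp_all

text \<open>Index addition wraps modulo 4, and two steps multiply by \<open>\<i>\<close>
  twice.\<close>

lemma Om_add_2: "Om (i + 2) = - Om i"
  using exhaust_4[of i] by (elim disjE) (simp_all add: Om_simps numerals_mod_4)

lemma Om_pow4: "Om i ^ 4 = - 1"
proof -
  have "omega 1 ^ 4 = -1"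
    using omega_1_square by (metis i_squared mult.assoc power4_eq_xxxx)
  then show ?thesis using exhaust_4[of i] by (elim disjE) (simp_all add: Om_simps power_mult_distrib)
qed

text \<open>The \<open>Om i\<close> are \<open>omega 1\<close> times the fourth roots of unity,
  whose power sums vanish unless 4 divides the exponent.\<close>

lemma sum_Om_powers: "(\<Sum>i\<in>UNIV. Om i ^ 1) = 0" "(\<Sum>i\<in>UNIV. Om i ^ 2) = 0" "(\<Sum>i\<in>UNIV. Om i ^ 3) = 0"
  by (simp_all add: sum_4 Om_simps power_mult_distrib power3_eq_cube)

lemma yvec_nth: "yvec \<alpha> x $ i = exp (Om i * complex_of_real \<alpha> * complex_of_real x)"
proof -
  have "yvec \<alpha> x = vector [exp (omega 1 * complex_of_real \<alpha> * complex_of_real x),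
     exp (omega 2 * complex_of_real \<alpha> * complex_of_real x),
     exp (omega 3 * complex_of_real \<alpha> * complex_of_real x),
     exp (omega 4 * complex_of_real \<alpha> * complex_of_real x)]" by (simp add: yvec_def)
  then show ?thesis using exhaust_4[of i] by (elim disjE) (simp_all add: vector_nth_4 Om_simps omega_simps)
qed

text \<open>
  If \<open>u\<close> is the sum of the modes \<open>b i\<close>, then \<open>moment \<alpha> b n\<close> is the \<open>n\<close>-th derivative of \<open>u\<close>
  for \<open>n \<le> 3\<close>.
\<close>

definition moment :: "real \<Rightarrow> (4 \<Rightarrow> real \<Rightarrow> complex) \<Rightarrow> nat \<Rightarrow> real \<Rightarrow> complex" where
  "moment \<alpha> b n x = (\<Sum>i\<in>UNIV. (Om i * complex_of_real \<alpha>) ^ n * b i x)"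

lemma Wmat_mult_vec:
  "Wmat \<alpha> x *v a = vector (map (\<lambda>n. moment \<alpha> (\<lambda>i x. yvec \<alpha> x $ i * a $ i) n x) [0, 1, 2, 3])"
  by (simp add: vec_eq_iff forall_4 matrix_vector_mult_def sum_4 Wmat_def mat4_nth_4 vector_nth_4 moment_def
       yvec_nth Om_simps omega_simps mult.assoc)

text \<open>\<open>Lsq\<close> shifts coordinates cyclically by two places, pairing each root with
  its negative.\<close>

lemma Omega_Lsq_mult_vec: "(Omega ** Lsq *v z) $ i = Om i * z $ (i + 2)"
  using exhaust_4[of i]
  by (elim disjE) (simp_all add: numerals_mod_4 matrix_vector_mult_def matrix_matrix_mult_def sum_4 Omega_def mat4_nth_4
       Lsq_def vector_nth_4 Om_simps omega_simps)

lemma bilin_expand: "bilin v A z = (\<Sum>j\<in>UNIV. (\<Sum>i\<in>UNIV. v $ i * A $ i $ j) * z $ j)"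
  unfolding bilin_def matrix_vector_mult_def
  by (simp add: sum_distrib_left sum_distrib_right mult.assoc) (rule sum.swap)

section \<open>Superpositions of exponential modes\<close>

lemma L2_absolutely_integrable:
  assumes "w \<in> L2 l"
  shows "w absolutely_integrable_on {-l..l}"
proof -
  have w: "w \<in> borel_measurable (lebesgue_on {-l..l})" "integrable (lebesgue_on {-l..l}) (\<lambda>x. (cmod (w x))\<^sup>2)"
    using assms by (auto simp: L2_def)
  have "integrable (lebesgue_on {-l..l}) w"
  proof (rule Bochner_Integration.integrable_bound[OF _ w(1)])
    show "integrable (lebesgue_on {-l..l}) (\<lambda>x. 1 + (cmod (w x))\<^sup>2)"
      using w(2) by (intro Bochner_Integration.integrable_add) (auto simp: integrable_const_ivl)
    have "cmod z \<le> 1 + (cmod z)\<^sup>2" for z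
    proof -
      have "2 * cmod z \<le> 1 + (cmod z)\<^sup>2"
        using zero_le_power2[of "cmod z - 1"] by (simp add: power2_eq_square algebra_simps)
      then show ?thesis using norm_ge_zero[of z] by linarith
    qed
    then show "AE x in lebesgue_on {-l..l}. cmod (w x) \<le> norm (1 + (cmod (w x))\<^sup>2)"
      by (auto intro!: AE_I2)
  qed
  then show ?thesis by (simp add: set_integrable_def integrable_restrict_space)
qed

lemma L2_norm_square_integrable:
  assumes "w \<in> L2 l"
  shows "(\<lambda>x. (cmod (w x))\<^sup>2) integrable_on {-l..l}"
  using assms by (intro integrable_on_lebesgue_on) (auto simp: L2_def)

text \<open>Young's inequality \<open>z \<le> 1 / (4 * \<eta>) + \<eta> * z\<^sup>2\<close> is
  integrated with \<open>z = cmod (w x)\<close>. The result has the shape demanded by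
  \<open>abs_continuous_funI\<close> with the squared modulus as \<open>g\<close>.\<close>

lemma integral_norm_le_L2:
  assumes w: "w \<in> L2 l" and "0 < \<eta>" "-l \<le> s" "s \<le> t" "t \<le> l"
  shows "cmod (integral {s..t} w) \<le> (t - s) / (4 * \<eta>) + \<eta> * integral {s..t} (\<lambda>x. (cmod (w x))\<^sup>2)"
proof -
  have sub: "{s..t} \<subseteq> {-l..l}" using assms by auto
  have i1: "w integrable_on {s..t}"
    using L2_absolutely_integrable[OF w] by (intro integrable_on_subinterval[OF _ sub]) (simp add: absolutely_integrable_on_def)
  have i2: "(\<lambda>x. (cmod (w x))\<^sup>2) integrable_on {s..t}"
    by (rule integrable_on_subinterval[OF L2_norm_square_integrable[OF w] sub])
  have "z \<le> 1 / (4 * \<eta>) + \<eta> * z\<^sup>2" for z :: real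
  proof -
    have "1 / (4 * \<eta>) + \<eta> * z\<^sup>2 - z = \<eta> * (z - 1 / (2 * \<eta>))\<^sup>2"
      using \<open>0 < \<eta>\<close> by (simp add: field_simps power2_eq_square)
    moreover have "0 \<le> \<eta> * (z - 1 / (2 * \<eta>))\<^sup>2" using \<open>0 < \<eta>\<close> by simp
    ultimately show ?thesis by linarith
  qed
  then have "cmod (integral {s..t} w) \<le> integral {s..t} (\<lambda>x. 1 / (4 * \<eta>) + \<eta> * (cmod (w x))\<^sup>2)"
    by (intro integral_norm_bound_integral i1 integrable_add integrable_const_ivl integrable_on_mult_right i2)
  also have "\<dots> = integral {s..t} (\<lambda>x. 1 / (4 * \<eta>)) + integral {s..t} (\<lambda>x. \<eta> * (cmod (w x))\<^sup>2)"
    by (rule integral_add) (intro integrable_const_ivl integrable_on_mult_right i2)+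
  also have "\<dots> = (t - s) / (4 * \<eta>) + \<eta> * integral {s..t} (\<lambda>x. (cmod (w x))\<^sup>2)"
    using \<open>s \<le> t\<close> by simp
  finally show ?thesis .
qed

text \<open>Assumption \<open>b\<close> encodes
  \<open>b i' = Om i * \<alpha> * b i - c * Om i * w\<close>, with the primitive of \<open>w\<close>
  moved to the left so that the derivative exists at every point. It is used with
  \<open>c = 0\<close> and \<open>w = 0\<close> for the homogeneous equation and with
  \<open>c = \<alpha> / (4 * k)\<close> for the operator.\<close>

context
  fixes l \<alpha> :: real and c :: complex and w :: "real \<Rightarrow> complex" and b :: "4 \<Rightarrow> real \<Rightarrow> complex"
    and u :: "real \<Rightarrow> complex"
  assumes l: "0 < l" and w: "w \<in> L2 l"
    and b: "\<And>i x. x \<in> {-l..l} \<Longrightarrow>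
      ((\<lambda>x. b i x + c * Om i * integral {-l..x} w) has_vector_derivative Om i * complex_of_real \<alpha> * b i x)
        (at x within {-l..l})"
    and u: "\<And>x. x \<in> {-l..l} \<Longrightarrow> u x = moment \<alpha> b 0 x"
begin

lemma moment_plus_has_vector_derivative:
  assumes "x \<in> {-l..l}"
  shows "((\<lambda>x. moment \<alpha> (\<lambda>i x. b i x + c * Om i * integral {-l..x} w) n x)
    has_vector_derivative moment \<alpha> b (Suc n) x) (at x within {-l..l})"
proof -
  have "((\<lambda>x. \<Sum>i\<in>UNIV. (Om i * complex_of_real \<alpha>) ^ n * (b i x + c * Om i * integral {-l..x} w))
      has_vector_derivative (\<Sum>i\<in>UNIV. (Om i * complex_of_real \<alpha>) ^ n * (Om i * complex_of_real \<alpha> * b i x)))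
      (at x within {-l..l})"
    by (intro has_vector_derivative_sum has_vector_derivative_mult_right b assms)
  then show ?thesis unfolding moment_def by (simp add: mult.assoc mult.left_commute)
qed

text \<open>The correction has its own factor \<open>Om i\<close>, so order \<open>n\<close> meets
  the power sum of exponent \<open>n + 1\<close>: it vanishes for the orders 0, 1, 2 and is
  \<open>- 4\<close> for order 3.\<close>

lemma moment_eq_moment_plus:
  "moment \<alpha> b n x = moment \<alpha> (\<lambda>i x. b i x + c * Om i * integral {-l..x} w) n x
     - c * complex_of_real \<alpha> ^ n * (\<Sum>i\<in>UNIV. Om i ^ Suc n) * integral {-l..x} w"
  unfolding moment_def
  by (simp add: sum_distrib_left sum_distrib_right sum_subtractf[symmetric] power_mult_distrib algebra_simps)

lemma moment_has_vector_derivative: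
  assumes "n < 3" "x \<in> {-l..l}"
  shows "(moment \<alpha> b n has_vector_derivative moment \<alpha> b (Suc n) x) (at x within {-l..l})"
proof -
  have "Suc n = 1 \<or> Suc n = 2 \<or> Suc n = 3" using assms by auto
  then have "(\<Sum>i\<in>UNIV. Om i ^ Suc n) = 0" by (elim disjE) (simp_all only: sum_Om_powers)
  then have "moment \<alpha> b n = (\<lambda>x. moment \<alpha> (\<lambda>i x. b i x + c * Om i * integral {-l..x} w) n x)"
    using moment_eq_moment_plus[of n] by (intro ext) simp
  then show ?thesis using moment_plus_has_vector_derivative[OF assms(2), of n] by simp
qed

lemma moment_3:
  "moment \<alpha> b 3 x = moment \<alpha> (\<lambda>i x. b i x + c * Om i * integral {-l..x} w) 3 x
     + 4 * c * complex_of_real \<alpha> ^ 3 * integral {-l..x} w"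
  using moment_eq_moment_plus[of 3 x] by (simp add: Om_pow4)

lemma moment_4: "moment \<alpha> b 4 x = - (complex_of_real (\<alpha> ^ 4) * moment \<alpha> b 0 x)"
  unfolding moment_def by (simp add: power_mult_distrib Om_pow4 sum_distrib_left sum_negf)

lemma ode_solution_moment:
  "ode_solution l \<alpha> (\<lambda>x. 4 * c * complex_of_real (\<alpha> ^ 3) * w x) u"
proof -
  \<comment> \<open>The third derivative splits into \<open>H\<close>, which is differentiable
    everywhere, and \<open>C\<close> times the primitive of \<open>w\<close>.\<close>
  define H where "H = moment \<alpha> (\<lambda>i x. b i x + c * Om i * integral {-l..x} w) 3"
  define C where "C = 4 * c * complex_of_real \<alpha> ^ 3"
  have H': "(H has_vector_derivative moment \<alpha> b 4 x) (at x within {-l..l})" if "x \<in> {-l..l}" for x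
    using moment_plus_has_vector_derivative[OF that, of 3] by (simp add: H_def)
  have m3: "moment \<alpha> b 3 x = H x + C * integral {-l..x} w" for x
    using moment_3[of x] by (simp add: H_def C_def)
  have wi: "w integrable_on {-l..l}"
    using L2_absolutely_integrable[OF w] by (simp add: absolutely_integrable_on_def)
  have cont: "continuous_on {-l..l} (moment \<alpha> b 3)"
    unfolding m3 using indefinite_integral_continuous_1[OF wi]
    by (intro continuous_intros continuous_on_vector_derivative[OF H'])
  have "continuous_on {-l..l} (moment \<alpha> b 0)"
    by (rule continuous_on_vector_derivative[where f' = "moment \<alpha> b (Suc 0)"]) (rule moment_has_vector_derivative, simp_all)
  then have cont4: "continuous_on {-l..l} (moment \<alpha> b 4)" unfolding moment_4 by (intro continuous_intros)
  then have "bounded (moment \<alpha> b 4 ` {-l..l})" by (intro compact_imp_bounded compact_continuous_image) auto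
  \<comment> \<open>Since \<open>moment \<alpha> b 4\<close> is the derivative of \<open>H\<close>,
    this \<open>K\<close> is a Lipschitz constant of \<open>H\<close>.\<close>
  then obtain K where K: "\<And>x. x \<in> {-l..l} \<Longrightarrow> cmod (moment \<alpha> b 4 x) \<le> K"
    unfolding bounded_iff by blast
  have AC: "abs_continuous_fun (-l) l (moment \<alpha> b 3)"
  proof (rule abs_continuous_funI[OF L2_norm_square_integrable[OF w]])
    fix \<eta> :: real assume "0 < \<eta>"
    \<comment> \<open>Young's parameter, scaled so that
      \<open>cmod C * \<theta> \<le> \<eta>\<close>; the added 1 allows
      \<open>C = 0\<close>.\<close>
    define \<theta> where "\<theta> = \<eta> / (cmod C + 1)"
    have C1: "0 < cmod C + 1" by (simp add: add_nonneg_pos)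
    then have "0 < \<theta>" using \<open>0 < \<eta>\<close> by (simp add: \<theta>_def)
    have "cmod (moment \<alpha> b 3 t - moment \<alpha> b 3 s) \<le> (K + cmod C / (4 * \<theta>)) * (t - s) + \<eta> * integral {s..t} (\<lambda>x. (cmod (w x))\<^sup>2)"
      if st: "-l \<le> s" "s < t" "t \<le> l" for s t
    proof -
      have "(moment \<alpha> b 4 has_integral H t - H s) {s..t}"
      proof (rule fundamental_theorem_of_calculus)
        show "(H has_vector_derivative moment \<alpha> b 4 x) (at x within {s..t})" if "x \<in> {s..t}" for x
          by (rule has_vector_derivative_within_subset[OF H']) (use that st in auto)
      qed (use st in simp)
      then have "cmod (H t - H s) \<le> K * measure lborel {s..t}"
      proof (rule has_integral_bound_real[where S = "{}", rotated 2])
        show "0 \<le> K" using order_trans[OF norm_ge_zero K[of 0]] l by simp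
        show "cmod (moment \<alpha> b 4 x) \<le> K" if "x \<in> {s..t} - {}" for x
          using that st by (intro K) auto
      qed simp
      then have HK: "cmod (H t - H s) \<le> K * (t - s)" using st by simp
      have V: "integral {-l..t} w - integral {-l..s} w = integral {s..t} w"
        using st by (intro integral_diff_initial[OF wi]) auto
      let ?I = "integral {s..t} (\<lambda>x. (cmod (w x))\<^sup>2)"
      have I: "0 \<le> ?I"
        by (intro integral_nonneg integrable_on_subinterval[OF L2_norm_square_integrable[OF w]]) (use st in auto)
      have "cmod C * cmod (integral {s..t} w) \<le> cmod C * ((t - s) / (4 * \<theta>) + \<theta> * ?I)"
        using st by (intro mult_left_mono integral_norm_le_L2[OF w \<open>0 < \<theta>\<close>]) auto
      also have "\<dots> = cmod C / (4 * \<theta>) * (t - s) + (cmod C * \<theta>) * ?I"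
        by (simp add: algebra_simps)
      also have "\<dots> \<le> cmod C / (4 * \<theta>) * (t - s) + \<eta> * ?I"
      proof -
        have "cmod C * \<theta> \<le> \<eta>" using C1 \<open>0 < \<eta>\<close> by (simp add: \<theta>_def field_simps)
        then show ?thesis using I by (simp add: mult_right_mono)
      qed
      finally have CV: "cmod (C * integral {s..t} w) \<le> cmod C / (4 * \<theta>) * (t - s) + \<eta> * ?I"
        by (simp add: norm_mult)
      have "moment \<alpha> b 3 t - moment \<alpha> b 3 s = (H t - H s) + C * integral {s..t} w"
        by (simp add: m3 V[symmetric] algebra_simps)
      then show ?thesis
        using norm_triangle_ineq[of "H t - H s" "C * integral {s..t} w"] HK CV by (simp add: distrib_right)
    qed
    then show "\<exists>L. \<forall>s t. - l \<le> s \<and> s < t \<and> t \<le> l \<longrightarrow>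
        cmod (moment \<alpha> b 3 t - moment \<alpha> b 3 s) \<le> L * (t - s) + \<eta> * integral {s..t} (\<lambda>x. (cmod (w x))\<^sup>2)"
      by blast
  qed simp
  \<comment> \<open>Only the fourth derivative requires differentiating the primitive of
    \<open>w\<close> itself, hence a null set.\<close>
  obtain N where N: "negligible N" "\<And>x. x \<in> {-l..l} - N \<Longrightarrow>
       ((\<lambda>y. integral {-l..y} w) has_vector_derivative w x) (at x within {-l..l})"
    by (rule indefinite_integral_has_derivative_negligible[OF wi]) (blast intro: that)
  show ?thesis
  proof (rule ode_solutionI[where D = "moment \<alpha> b" and N = N, OF l])
    show "(moment \<alpha> b 3 has_vector_derivative
       4 * c * complex_of_real (\<alpha> ^ 3) * w x - complex_of_real (\<alpha>^4) * u x) (at x within {-l..l})"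
      if x: "x \<in> {-l..l} - N" for x
    proof -
      have "((\<lambda>x. H x + C * integral {-l..x} w) has_vector_derivative moment \<alpha> b 4 x + C * w x) (at x within {-l..l})"
        using x by (intro has_vector_derivative_add has_vector_derivative_mult_right H' N) auto
      then show ?thesis unfolding m3[symmetric] using x by (simp add: moment_4 C_def u)
    qed
  qed (use cont AC N(1) moment_has_vector_derivative u in auto)
qed

lemma nderiv_moment:
  assumes "n \<le> 3" "x \<in> {-l..l}"
  shows "nderiv l n u x = moment \<alpha> b n x"
  using assms by (intro nderiv_eqI[OF l]) (auto intro!: moment_has_vector_derivative simp: u)

lemma mult_bdry_moment:
  assumes a: "\<And>i x. x \<in> {-l..l} \<Longrightarrow> b i x = yvec \<alpha> x $ i * a x $ i"
  shows "M *v bdry l u = Mtilde_minus l \<alpha> M *v a (-l) + Mtilde_plus l \<alpha> M *v a l"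
proof -
  \<comment> \<open>\<open>moment\<close> involves the modes at the point \<open>x\<close> only, so
    the coefficients may be frozen at \<open>a x\<close>; no derivative of \<open>a\<close>
    enters.\<close>
  have W: "Wmat \<alpha> x *v a x = vector [moment \<alpha> b 0 x, moment \<alpha> b 1 x, moment \<alpha> b 2 x, moment \<alpha> b 3 x]"
    if "x \<in> {-l..l}" for x
    unfolding Wmat_mult_vec using that by (simp add: moment_def a)
  have "bdry l u = vector [moment \<alpha> b 0 (-l), moment \<alpha> b 1 (-l), moment \<alpha> b 2 (-l), moment \<alpha> b 3 (-l),
      moment \<alpha> b 0 l, moment \<alpha> b 1 l, moment \<alpha> b 2 l, moment \<alpha> b 3 l]"
    using l by (simp add: bdry_def nderiv_moment)
  then have "M *v bdry l u = Mminus M *v (Wmat \<alpha> (-l) *v a (-l)) + Mplus M *v (Wmat \<alpha> l *v a l)"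
    using l by (simp add: matrix_vector_mult_halves W)
  then show ?thesis by (simp add: Mtilde_minus_def Mtilde_plus_def matrix_vector_mul_assoc)
qed

end

text \<open>After division by the powers of \<open>\<alpha>\<close> and \<open>omega 1\<close>, the
  four conditions say that the discrete Fourier transform of order 4 of \<open>z\<close> vanishes.
  It is inverted by hand below.\<close>

lemma vec_eq_0_if_moments_eq_0:
  fixes z :: "complex^4"
  assumes "0 < \<alpha>" and z: "\<And>n. n \<le> 3 \<Longrightarrow> (\<Sum>i\<in>UNIV. (Om i * complex_of_real \<alpha>) ^ n * z $ i) = 0"
  shows "z = 0"
proof -
  define s where "s = omega 1"
  have s: "s * s = \<i>" "s \<noteq> 0" using omega_1_square by (auto simp: s_def)
  have z': "(\<Sum>i\<in>UNIV. Om i ^ n * z $ i) = 0" if "n \<le> 3" for n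
  proof -
    have "complex_of_real \<alpha> ^ n * (\<Sum>i\<in>UNIV. Om i ^ n * z $ i) = 0"
      using z[OF that] by (simp add: sum_distrib_left power_mult_distrib mult_ac)
    then show ?thesis using \<open>0 < \<alpha>\<close> by simp
  qed
  have 0: "z $ 1 + z $ 2 + z $ 3 + z $ 4 = 0" using z'[of 0] by (simp add: sum_4)
  have "s * (z $ 1 + \<i> * z $ 2 - z $ 3 - \<i> * z $ 4) = 0"
    using z'[of 1] by (simp add: sum_4 Om_simps s_def algebra_simps)
  then have 1: "z $ 1 + \<i> * z $ 2 - z $ 3 - \<i> * z $ 4 = 0" using s by simp
  have "(s * s) * (z $ 1 - z $ 2 + z $ 3 - z $ 4) = 0"
    using z'[of 2] by (simp add: sum_4 Om_simps s_def power2_eq_square algebra_simps)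
  then have 2: "z $ 1 - z $ 2 + z $ 3 - z $ 4 = 0" using s by simp
  have "(s * s * s) * (z $ 1 - \<i> * z $ 2 - z $ 3 + \<i> * z $ 4) = 0"
    using z'[of 3] by (simp add: sum_4 Om_simps s_def power3_eq_cube algebra_simps)
  then have 3: "z $ 1 - \<i> * z $ 2 - z $ 3 + \<i> * z $ 4 = 0" using s by simp
  have "4 * z $ 1 = (z $ 1 + z $ 2 + z $ 3 + z $ 4) + (z $ 1 - z $ 2 + z $ 3 - z $ 4)
      + (z $ 1 + \<i> * z $ 2 - z $ 3 - \<i> * z $ 4) + (z $ 1 - \<i> * z $ 2 - z $ 3 + \<i> * z $ 4)" by simp
  then have z1: "z $ 1 = 0" unfolding 0 1 2 3 by simp
  have "4 * z $ 3 = (z $ 1 + z $ 2 + z $ 3 + z $ 4) + (z $ 1 - z $ 2 + z $ 3 - z $ 4)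
      - (z $ 1 + \<i> * z $ 2 - z $ 3 - \<i> * z $ 4) - (z $ 1 - \<i> * z $ 2 - z $ 3 + \<i> * z $ 4)" by simp
  then have z3: "z $ 3 = 0" unfolding 0 1 2 3 by simp
  have z24: "z $ 4 = - z $ 2" using 0 z1 z3 by (simp add: add_eq_0_iff)
  have "2 * \<i> * z $ 2 = 0" using 1 unfolding z1 z3 z24 by simp
  then have "z $ 2 = 0" by simp
  with z1 z3 z24 show ?thesis by (simp add: vec_eq_iff forall_4)
qed

text \<open>A kernel vector \<open>z\<close> gives the homogeneous solution with constant
  coefficients \<open>z\<close>, whose boundary values are annihilated by \<open>M\<close>.
  Well-posedness makes it zero, hence all its derivatives, and these determine
  \<open>z\<close>.\<close>

lemma Mtilde_right_inverse:
  assumes l: "0 < l" and "0 < \<alpha>" and M: "M \<in> wp l \<alpha>"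
  shows "Mtilde l \<alpha> M ** matrix_inv (Mtilde l \<alpha> M) = mat 1"
proof -
  have "z = 0" if z: "Mtilde l \<alpha> M *v z = 0" for z
  proof -
    define b where "b i x = yvec \<alpha> x $ i * z $ i" for i x
    have w: "(\<lambda>x. 0) \<in> L2 l" by (simp add: L2_def)
    have b: "((\<lambda>x. b i x + 0 * Om i * integral {-l..x} (\<lambda>x. 0)) has_vector_derivative
        Om i * complex_of_real \<alpha> * b i x) (at x within {-l..l})" for i x
      using has_vector_derivative_mult_left[OF has_vector_derivative_exp_mult[of "Om i * complex_of_real \<alpha>" x "{-l..l}"], of "z $ i"]
      by (simp add: b_def yvec_nth mult.assoc)
    have "ode_solution l \<alpha> (\<lambda>x. 0) (moment \<alpha> b 0)"
      using ode_solution_moment[where c = 0, OF l w b refl] by simp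
    moreover have "M *v bdry l (moment \<alpha> b 0) = Mtilde_minus l \<alpha> M *v z + Mtilde_plus l \<alpha> M *v z"
      by (rule mult_bdry_moment[where c = 0 and a = "\<lambda>x. z", OF l w b refl]) (simp_all add: b_def)
    ultimately have "bvp_solution l \<alpha> M (\<lambda>x. 0) (moment \<alpha> b 0)"
      using z by (simp add: bvp_solution_def Mtilde_def matrix_vector_mult_add_rdistrib)
    then have u: "moment \<alpha> b 0 x = 0" if "x \<in> {-l..l}" for x
      using M that unfolding wp_def by blast
    show "z = 0"
    proof (rule vec_eq_0_if_moments_eq_0[OF \<open>0 < \<alpha>\<close>])
      fix n :: nat assume "n \<le> 3"
      \<comment> \<open>At the point 0 all exponentials equal 1, so the derivatives there are the
        plain moments of \<open>z\<close>.\<close>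
      have "nderiv l n (moment \<alpha> b 0) 0 = 0"
        using l by (intro nderiv_eqI[OF l, where D = "\<lambda>n x. 0"]) (auto simp: u)
      then have "moment \<alpha> b n 0 = 0"
        using nderiv_moment[where c = 0, OF l w b refl \<open>n \<le> 3\<close>, of 0] l by simp
      then show "(\<Sum>i\<in>UNIV. (Om i * complex_of_real \<alpha>) ^ n * z $ i) = 0"
        by (simp add: moment_def b_def yvec_nth)
    qed
  qed
  then have "\<exists>B. B ** Mtilde l \<alpha> M = mat 1"
    by (simp add: matrix_left_invertible_ker)
  then have "invertible (Mtilde l \<alpha> M)" by (simp add: invertible_left_inverse)
  then show ?thesis unfolding matrix_inv_def invertible_def by (metis (mono_tags, lifting) someI_ex)
qed

section \<open>The integral operator\<close>

text \<open>With \<open>S = {-l..x}\<close> this is the vector \<open>J(x)\<close> of variation of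
  constants; a general \<open>S\<close> also covers the part of the interval to the right of
  \<open>x\<close>.\<close>

definition ymoments :: "real \<Rightarrow> (real \<Rightarrow> complex) \<Rightarrow> real set \<Rightarrow> complex^4" where
  "ymoments \<alpha> w S = (\<chi> j. integral S (\<lambda>\<xi>. yvec \<alpha> \<xi> $ j * w \<xi>))"

lemma continuous_on_yvec: "continuous_on S (\<lambda>x. yvec \<alpha> x $ i)"
  unfolding yvec_nth by (intro continuous_intros)

lemma yvec_mult_absolutely_integrable:
  "w absolutely_integrable_on {a..b} \<Longrightarrow> (\<lambda>\<xi>. yvec \<alpha> \<xi> $ i * w \<xi>) absolutely_integrable_on {a..b}"
  by (intro absolutely_integrable_continuous_mult continuous_on_yvec)

lemma has_bochner_integral_bilin:
  assumes w: "w absolutely_integrable_on {a..b}"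
  shows "has_bochner_integral (lebesgue_on {a..b}) (\<lambda>\<xi>. bilin v A (yvec \<alpha> \<xi>) * w \<xi>)
           (bilin v A (ymoments \<alpha> w {a..b}))"
proof -
  have y: "(\<lambda>\<xi>. yvec \<alpha> \<xi> $ j * w \<xi>) integrable_on {a..b}" for j
    using yvec_mult_absolutely_integrable[OF w] by (simp add: absolutely_integrable_on_def)
  have "(\<lambda>\<xi>. bilin v A (yvec \<alpha> \<xi>) * w \<xi>) absolutely_integrable_on {a..b}"
    unfolding bilin_expand
    by (intro absolutely_integrable_continuous_mult[OF _ w] continuous_intros continuous_on_yvec)
  then have I: "integrable (lebesgue_on {a..b}) (\<lambda>\<xi>. bilin v A (yvec \<alpha> \<xi>) * w \<xi>)"
    by (simp add: absolutely_integrable_imp_integrable)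
  have "integral {a..b} (\<lambda>\<xi>. bilin v A (yvec \<alpha> \<xi>) * w \<xi>)
      = integral {a..b} (\<lambda>\<xi>. \<Sum>j\<in>UNIV. (\<Sum>i\<in>UNIV. v $ i * A $ i $ j) * (yvec \<alpha> \<xi> $ j * w \<xi>))"
    by (simp add: bilin_expand sum_distrib_right mult.assoc)
  also have "\<dots> = (\<Sum>j\<in>UNIV. integral {a..b} (\<lambda>\<xi>. (\<Sum>i\<in>UNIV. v $ i * A $ i $ j) * (yvec \<alpha> \<xi> $ j * w \<xi>)))"
    by (intro integral_sum integrable_on_mult_right y) simp
  also have "\<dots> = bilin v A (ymoments \<alpha> w {a..b})"
    by (simp add: bilin_expand ymoments_def)
  finally show ?thesis
    using I by (simp add: has_bochner_integral_iff lebesgue_integral_eq_integral)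
qed

lemma matrix_add_rdistrib: "(A + B) ** C = A ** C + B ** (C :: 'a::semiring_1^'n^'m)"
  by (simp add: vec_eq_iff matrix_matrix_mult_def distrib_right sum.distrib)

text \<open>The transformed halves add up to the matrix whose inverse stands in front of
  both.\<close>

lemma Gminus_add_Gplus:
  assumes "0 < l" "0 < \<alpha>" "M \<in> wp l \<alpha>"
  shows "Gminus l \<alpha> M + Gplus l \<alpha> M = Omega ** Lsq"
proof -
  have "matrix_inv (Mtilde l \<alpha> M) ** Mtilde l \<alpha> M = mat 1"
    using Mtilde_right_inverse[OF assms] matrix_left_right_inverse by blast
  moreover have "Gminus l \<alpha> M + Gplus l \<alpha> M = matrix_inv (Mtilde l \<alpha> M) ** Mtilde l \<alpha> M ** (Omega ** Lsq)"
    by (simp add: Gminus_def Gplus_def Mtilde_def matrix_mul_assoc matrix_add_ldistrib matrix_add_rdistrib)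
  ultimately show ?thesis by (simp only: matrix_mul_lid)
qed

lemma bilin_add_mat: "bilin v (A + B) z = bilin v A z + bilin v B z"
  by (simp add: bilin_def matrix_vector_mult_add_rdistrib distrib_left sum.distrib)

lemma yvec_mult_opposite: "yvec \<alpha> x $ i * yvec \<alpha> x $ (i + 2) = 1"
  by (simp add: yvec_nth Om_add_2 flip: exp_add)

text \<open>Opposite exponents cancel and leave the sum of the roots. This is why the two branches
  of the kernel agree on the diagonal.\<close>

lemma bilin_Omega_Lsq: "bilin (yvec \<alpha> x) (Omega ** Lsq) (yvec \<alpha> x) = 0"
proof -
  have "bilin (yvec \<alpha> x) (Omega ** Lsq) (yvec \<alpha> x) = (\<Sum>i\<in>UNIV. Om i * (yvec \<alpha> x $ i * yvec \<alpha> x $ (i + 2)))"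
    unfolding bilin_def Omega_Lsq_mult_vec by (simp add: mult_ac)
  also have "\<dots> = 0" using sum_Om_powers(1) by (simp add: yvec_mult_opposite)
  finally show ?thesis .
qed

lemma bilin_diff_vec: "bilin v A (y - z) = bilin v A y - bilin v A z"
  by (simp add: bilin_def matrix_vector_mult_diff_distrib right_diff_distrib sum_subtractf)

lemma Kop_eq:
  assumes l: "0 < l" "0 < \<alpha>" "M \<in> wp l \<alpha>" and w: "w absolutely_integrable_on {-l..l}" and x: "x \<in> {-l..l}"
  shows "Kop l \<alpha> k M w x = complex_of_real (\<alpha> / (4 * k)) *
     (\<Sum>i\<in>UNIV. yvec \<alpha> x $ i * (Gplus l \<alpha> M *v ymoments \<alpha> w {-l..l} - (Omega ** Lsq) *v ymoments \<alpha> w {-l..x}) $ i)"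
proof -
  define c where "c = complex_of_real (\<alpha> / (4 * k))"
  have 0: "bilin (yvec \<alpha> x) (Gminus l \<alpha> M) (yvec \<alpha> x) + bilin (yvec \<alpha> x) (Gplus l \<alpha> M) (yvec \<alpha> x) = 0"
    by (simp only: bilin_add_mat[symmetric] Gminus_add_Gplus[OF l] bilin_Omega_Lsq)
  then have neg: "bilin (yvec \<alpha> x) (Gplus l \<alpha> M) (yvec \<alpha> x) = - bilin (yvec \<alpha> x) (Gminus l \<alpha> M) (yvec \<alpha> x)"
    by (simp add: eq_neg_iff_add_eq_0 add.commute)
  have w1: "w absolutely_integrable_on {-l..x}" and w2: "w absolutely_integrable_on {x..l}"
    using w x by (auto intro: absolutely_integrable_on_subinterval)
  have y: "(\<lambda>\<xi>. yvec \<alpha> \<xi> $ j * w \<xi>) integrable_on {-l..l}" for j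
    using yvec_mult_absolutely_integrable[OF w] by (simp add: absolutely_integrable_on_def)
  have "has_bochner_integral (lebesgue_on {-l..l}) (\<lambda>\<xi>. Gfun l \<alpha> k M x \<xi> * w \<xi>)
     (- c * bilin (yvec \<alpha> x) (Gminus l \<alpha> M) (ymoments \<alpha> w {-l..x})
      + c * bilin (yvec \<alpha> x) (Gplus l \<alpha> M) (ymoments \<alpha> w {x..l}))"
  proof (rule has_bochner_integral_combine[of _ x])
    have "has_bochner_integral (lebesgue_on {-l..x}) (\<lambda>\<xi>. - c * (bilin (yvec \<alpha> x) (Gminus l \<alpha> M) (yvec \<alpha> \<xi>) * w \<xi>))
       (- c * bilin (yvec \<alpha> x) (Gminus l \<alpha> M) (ymoments \<alpha> w {-l..x}))"
      by (intro has_bochner_integral_mult_right has_bochner_integral_bilin w1)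
    \<comment> \<open>At \<open>\<xi> = x\<close> the kernel takes the \<open>Gplus\<close> branch,
      which \<open>neg\<close> converts.\<close>
    moreover have "Gfun l \<alpha> k M x \<xi> * w \<xi> = - c * (bilin (yvec \<alpha> x) (Gminus l \<alpha> M) (yvec \<alpha> \<xi>) * w \<xi>)"
      if "\<xi> \<in> {-l..x}" for \<xi>
      using that by (cases "\<xi> = x") (auto simp: Gfun_def c_def neg)
    ultimately show "has_bochner_integral (lebesgue_on {-l..x}) (\<lambda>\<xi>. Gfun l \<alpha> k M x \<xi> * w \<xi>)
       (- c * bilin (yvec \<alpha> x) (Gminus l \<alpha> M) (ymoments \<alpha> w {-l..x}))"
      by (subst has_bochner_integral_cong[OF refl _ refl]) auto
    have "has_bochner_integral (lebesgue_on {x..l}) (\<lambda>\<xi>. c * (bilin (yvec \<alpha> x) (Gplus l \<alpha> M) (yvec \<alpha> \<xi>) * w \<xi>))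
       (c * bilin (yvec \<alpha> x) (Gplus l \<alpha> M) (ymoments \<alpha> w {x..l}))"
      by (intro has_bochner_integral_mult_right has_bochner_integral_bilin w2)
    then show "has_bochner_integral (lebesgue_on {x..l}) (\<lambda>\<xi>. Gfun l \<alpha> k M x \<xi> * w \<xi>)
       (c * bilin (yvec \<alpha> x) (Gplus l \<alpha> M) (ymoments \<alpha> w {x..l}))"
      by (subst has_bochner_integral_cong[OF refl _ refl]) (auto simp: Gfun_def c_def)
  qed (use x in auto)
  then have "Kop l \<alpha> k M w x = - c * bilin (yvec \<alpha> x) (Gminus l \<alpha> M) (ymoments \<alpha> w {-l..x})
      + c * bilin (yvec \<alpha> x) (Gplus l \<alpha> M) (ymoments \<alpha> w {x..l})"
    unfolding Kop_def by (rule has_bochner_integral_integral_eq)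
  also have "ymoments \<alpha> w {x..l} = ymoments \<alpha> w {-l..l} - ymoments \<alpha> w {-l..x}"
    using integral_diff_initial[OF y, of x l] x by (simp add: vec_eq_iff ymoments_def)
  \<comment> \<open>The terms with the integral up to \<open>x\<close> combine to
    \<open>Gminus + Gplus\<close>, that is \<open>Omega ** Lsq\<close>; the rest has a constant
    coefficient vector.\<close>
  also have "- c * bilin (yvec \<alpha> x) (Gminus l \<alpha> M) (ymoments \<alpha> w {-l..x})
      + c * bilin (yvec \<alpha> x) (Gplus l \<alpha> M) (ymoments \<alpha> w {-l..l} - ymoments \<alpha> w {-l..x})
      = c * (bilin (yvec \<alpha> x) (Gplus l \<alpha> M) (ymoments \<alpha> w {-l..l})
         - bilin (yvec \<alpha> x) (Gminus l \<alpha> M + Gplus l \<alpha> M) (ymoments \<alpha> w {-l..x}))"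
    by (simp add: bilin_diff_vec bilin_add_mat algebra_simps)
  also have "\<dots> = c * (\<Sum>i\<in>UNIV. yvec \<alpha> x $ i *
      (Gplus l \<alpha> M *v ymoments \<alpha> w {-l..l} - (Omega ** Lsq) *v ymoments \<alpha> w {-l..x}) $ i)"
    unfolding Gminus_add_Gplus[OF l] by (simp add: bilin_def right_diff_distrib sum_subtractf)
  finally show ?thesis by (simp add: c_def)
qed

lemma Kop_is_solution:
  assumes l: "0 < l" and \<alpha>: "0 < \<alpha>" and k: "0 < k" and M: "M \<in> wp l \<alpha>" and w: "w \<in> L2 l"
  shows "bvp_solution l \<alpha> M (\<lambda>x. complex_of_real (\<alpha>^4 / k) * w x) (Kop l \<alpha> k M w)"
proof -
  define c where "c = complex_of_real (\<alpha> / (4 * k))"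
  define J where "J x = ymoments \<alpha> w {-l..x}" for x
  define K where "K = Gplus l \<alpha> M *v J l"
  define a where "a x = c *s (K - (Omega ** Lsq) *v J x)" for x
  define b where "b i x = yvec \<alpha> x $ i * a x $ i" for i x
  have wa: "w absolutely_integrable_on {-l..l}" by (rule L2_absolutely_integrable[OF w])
  have b: "((\<lambda>x. b i x + c * Om i * integral {-l..x} w) has_vector_derivative Om i * complex_of_real \<alpha> * b i x)
      (at x within {-l..l})" if x: "x \<in> {-l..l}" for i x
  proof -
    let ?c = "Om i * complex_of_real \<alpha>"
    define E where "E y = exp (?c * complex_of_real y) * integral {-l..y} (\<lambda>t. exp (- ?c * complex_of_real t) * w t)" for y
    \<comment> \<open>Component \<open>i\<close> of \<open>(Omega ** Lsq) *v J y\<close> is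
      \<open>Om i\<close> times component \<open>i + 2\<close> of \<open>J y\<close>, whose weight
      is the exponential with the opposite exponent; this produces the convolution
      \<open>E\<close>.\<close>
    have bE: "b i y = c * K $ i * exp (?c * complex_of_real y) - c * Om i * E y" for y
      unfolding b_def a_def E_def
      by (simp add: Omega_Lsq_mult_vec J_def ymoments_def yvec_nth Om_add_2 algebra_simps)
    have "((\<lambda>y. E y - integral {-l..y} w) has_vector_derivative ?c * E x) (at x within {-l..l})"
      unfolding E_def by (rule has_vector_derivative_exp_convolution[OF wa x])
    then have "((\<lambda>y. c * K $ i * exp (?c * complex_of_real y) - c * Om i * (E y - integral {-l..y} w)) has_vector_derivative
        c * K $ i * (?c * exp (?c * complex_of_real x)) - c * Om i * (?c * E x)) (at x within {-l..l})"
      by (intro has_vector_derivative_diff has_vector_derivative_mult_right has_vector_derivative_exp_mult)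
    then show ?thesis by (simp add: bE algebra_simps)
  qed
  have u: "Kop l \<alpha> k M w x = moment \<alpha> b 0 x" if "x \<in> {-l..l}" for x
    unfolding Kop_eq[OF l \<alpha> M wa that]
    by (simp add: moment_def b_def a_def K_def J_def c_def sum_distrib_left algebra_simps)
  \<comment> \<open>The factor 4 from the power sum cancels the 4 in the normalisation of the
    kernel.\<close>
  have "4 * c * complex_of_real (\<alpha> ^ 3) = complex_of_real (4 * (\<alpha> / (4 * k)) * \<alpha> ^ 3)"
    by (simp add: c_def)
  also have "4 * (\<alpha> / (4 * k)) * \<alpha> ^ 3 = \<alpha> ^ 4 / k"
    using k by (simp add: power4_eq_xxxx power3_eq_cube)
  finally have f: "4 * c * complex_of_real (\<alpha> ^ 3) = complex_of_real (\<alpha> ^ 4 / k)" .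
  have ode: "ode_solution l \<alpha> (\<lambda>x. complex_of_real (\<alpha>^4 / k) * w x) (Kop l \<alpha> k M w)"
    using ode_solution_moment[OF l w b u] unfolding f .
  \<comment> \<open>Hence \<open>a (- l)\<close> is \<open>c *s K\<close>, while \<open>a l\<close>
    carries the full integral; the matrix in front of \<open>K\<close> becomes
    \<open>Mtilde\<close>.\<close>
  have J0: "J (- l) = 0" by (simp add: J_def ymoments_def vec_eq_iff)
  have "M *v bdry l (Kop l \<alpha> k M w) = Mtilde_minus l \<alpha> M *v a (-l) + Mtilde_plus l \<alpha> M *v a l"
    by (rule mult_bdry_moment[OF l w b u]) (simp_all add: b_def)
  also have "\<dots> = c *s (Mtilde_minus l \<alpha> M *v K + Mtilde_plus l \<alpha> M *v K - Mtilde_plus l \<alpha> M *v ((Omega ** Lsq) *v J l))"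
    by (simp add: a_def J0 vector_scalar_commute matrix_vector_mult_diff_distrib
        vector_add_ldistrib vector_ssub_ldistrib)
  also have "Mtilde_minus l \<alpha> M *v K + Mtilde_plus l \<alpha> M *v K = Mtilde l \<alpha> M *v K"
    by (simp add: Mtilde_def matrix_vector_mult_add_rdistrib)
  also have "\<dots> = Mtilde l \<alpha> M ** matrix_inv (Mtilde l \<alpha> M) ** Mtilde_plus l \<alpha> M ** (Omega ** Lsq) *v J l"
    by (simp add: K_def Gplus_def matrix_vector_mul_assoc matrix_mul_assoc)
  also have "\<dots> = Mtilde_plus l \<alpha> M *v ((Omega ** Lsq) *v J l)"
    unfolding Mtilde_right_inverse[OF l \<alpha> M] by (simp add: matrix_vector_mul_assoc)
  finally show ?thesis using ode by (simp add: bvp_solution_def)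
qed

section \<open>Uniqueness and conclusion\<close>

lemma bvp_solution_diff:
  assumes l: "0 < l" and u: "bvp_solution l \<alpha> M f u" and v: "bvp_solution l \<alpha> M f v"
  shows "bvp_solution l \<alpha> M (\<lambda>x. 0) (\<lambda>x. u x - v x)"
proof -
  have C: "C3_on l u" "C3_on l v" using u v by (auto simp: bvp_solution_def ode_solution_def)
  have "bdry l (\<lambda>x. u x - v x) $ i = (bdry l u - bdry l v) $ i" for i
    using exhaust_8[of i] l
    by (elim disjE) (simp_all add: bdry_def vector_nth_8 nderiv_diff[OF l C])
  then have "bdry l (\<lambda>x. u x - v x) = bdry l u - bdry l v" by (simp add: vec_eq_iff)
  then show ?thesis
    using u v ode_solution_diff[OF l] by (auto simp: bvp_solution_def matrix_vector_mult_diff_distrib)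
qed

theorem lemma3p2:
  fixes l \<alpha> k :: real and M :: "complex^8^4" and w :: "real \<Rightarrow> complex"
  assumes "l > 0" and "\<alpha> > 0" and "k > 0"
    and "M \<in> wp l \<alpha>"
    and "w \<in> L2 l"
  shows "bvp_solution l \<alpha> M (\<lambda>x. complex_of_real (\<alpha>^4 / k) * w x) (Kop l \<alpha> k M w) \<and>
         (\<forall>u. bvp_solution l \<alpha> M (\<lambda>x. complex_of_real (\<alpha>^4 / k) * w x) u \<longrightarrow>
              (\<forall>x\<in>{-l..l}. u x = Kop l \<alpha> k M w x))"
proof (intro conjI allI impI ballI)
  show *: "bvp_solution l \<alpha> M (\<lambda>x. complex_of_real (\<alpha>^4 / k) * w x) (Kop l \<alpha> k M w)"
    using assms by (rule Kop_is_solution)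
  fix u x assume "bvp_solution l \<alpha> M (\<lambda>x. complex_of_real (\<alpha>^4 / k) * w x) u" and x: "x \<in> {-l..l}"
  from bvp_solution_diff[OF assms(1) this(1) *] assms(4) x
  have "u x - Kop l \<alpha> k M w x = 0" unfolding wp_def by blast
  then show "u x = Kop l \<alpha> k M w x" by simp
qed

end
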